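(* Let $g_n\colon\mathbb{D}\to\mathbb{D}$, $n\in\mathbb{N}$, be inner functions with $g_n(0)=0$. Let $G_n = g_n\circ\cdots\circ g_1$ for $n\ge 1$, and $G_m^n = g_n\circ\cdots\circ g_{m+1}$ for $n>m\ge 0$. Then the sequence of boundary maps $\{\widehat G_n\}_{n\in\mathbb{N}}$ is ergodic if and only if $$\lim_{N\to+\infty}\operatorname{Re}\left(\frac{1}{N^2}\sum_{m=1}^{N-1}\sum_{n=m+1}^{N}\left((G_m^n)'(0)\right)^\ell\right)=0$$ for every $\ell\in\mathbb{N}$.
   Context: $\mathbb{D}$ is the open unit disc in $\mathbb{C}$, $m$ (as a measure) is normalised Lebesgue measure on $\partial\mathbb{D}$, and $\mathbb{N}=\{1,2,3,\dots\}$. An analytic map $g\colon\mathbb{D}\to\mathbb{D}$ is inner if $\hat g(e^{i\theta})=\lim_{r\nearrow 1}g(re^{i\theta})$ exists and has modulus one for almost every $e^{i\theta}\in\partial\mathbb{D}$; $\hat g$ is its (a.e. defined) boundary map. If $g(0)=0$, then $\hat g$ preserves $m$. A sequence $\{T_n\}_{n\in\mathbb{N}}$ of measure-preserving maps of a probability space $(X,\mathcal{A},\mu)$ is called ergodic if $\lim_{N\to\infty}\left\|\frac1N\sum_{n=1}^N\varphi\circ T_n-\int_X\varphi\,d\mu\right\|_{2}=0$ for every complex-valued $\varphi\in L^2(\mu)$. For boundary maps this is applied with $(X,\mu)=(\partial\mathbb{D},m)$. *)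

theory Defs
  imports "HOL-Probability.Probability" "HOL-Complex_Analysis.Complex_Analysis"
begin

definition circle_measure :: "complex measure" where
  "circle_measure =
     completion (distr (uniform_measure lborel {0..<2 * pi}) (restrict_space borel (sphere 0 1)) cis)"

lemma prob_space_circle_measure: "prob_space circle_measure"
proof -
  interpret U: prob_space "uniform_measure lborel {0..<2 * pi}"
    by (rule prob_space_uniform_measure) auto
  have "cis \<in> borel_measurable borel"
    by (intro borel_measurable_continuous_onI continuous_intros)
  then have "cis \<in> uniform_measure lborel {0..<2 * pi} \<rightarrow>\<^sub>M restrict_space borel (sphere 0 1)"
    by (intro measurable_restrict_space2) auto
  then have "prob_space (distr (uniform_measure lborel {0..<2 * pi}) (restrict_space borel (sphere 0 1)) cis)"
    by (rule U.prob_space_distr)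
  then show ?thesis
    unfolding circle_measure_def by (rule prob_space.prob_space_completion)
qed

lemma space_circle_measure: "space circle_measure = sphere 0 1"
  by (simp add: circle_measure_def space_restrict_space)

definition inner_function :: "(complex \<Rightarrow> complex) \<Rightarrow> bool" where
  "inner_function g \<longleftrightarrow>
     g holomorphic_on ball 0 1 \<and> g \<in> ball 0 1 \<rightarrow> ball 0 1 \<and>
     (AE z in circle_measure.
        \<exists>w. norm w = 1 \<and> ((\<lambda>r. g (of_real r * z)) \<longlongrightarrow> w) (at_left (1::real)))"

text \<open>The radial limit of an inner function exists and is unimodular only almost everywhere.
  On the exceptional null set the value is set to 1, so that the boundary map is a
  self-map of the unit circle.\<close>

definition boundary_map :: "(complex \<Rightarrow> complex) \<Rightarrow> complex \<Rightarrow> complex" where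
  "boundary_map g z =
     (if \<exists>w. norm w = 1 \<and> ((\<lambda>r. g (of_real r * z)) \<longlongrightarrow> w) (at_left (1::real))
      then Lim (at_left (1::real)) (\<lambda>r. g (of_real r * z)) else 1)"

text \<open>\<open>comp_seq g m n\<close> is the composition of \<open>g (m+1)\<close>, ..., \<open>g n\<close>, with \<open>g (m+1)\<close> applied first;
  it is the identity if \<open>n \<le> m\<close>.\<close>

definition comp_seq :: "(nat \<Rightarrow> 'a \<Rightarrow> 'a) \<Rightarrow> nat \<Rightarrow> nat \<Rightarrow> 'a \<Rightarrow> 'a" where
  "comp_seq g m n = fold (\<lambda>k f. g k \<circ> f) [Suc m..<Suc n] id"

definition square_integrable :: "'a measure \<Rightarrow> ('a \<Rightarrow> complex) \<Rightarrow> bool" where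
  "square_integrable M f \<longleftrightarrow> f \<in> borel_measurable M \<and> integrable M (\<lambda>x. (norm (f x))\<^sup>2)"

definition L2_norm :: "'a measure \<Rightarrow> ('a \<Rightarrow> complex) \<Rightarrow> real" where
  "L2_norm M f = sqrt (LINT x|M. (norm (f x))\<^sup>2)"

definition measure_preserving :: "'a measure \<Rightarrow> ('a \<Rightarrow> 'a) \<Rightarrow> bool" where
  "measure_preserving M T \<longleftrightarrow> T \<in> M \<rightarrow>\<^sub>M M \<and> distr M M T = M"

text \<open>Sequences are indexed by the positive integers; \<open>T 0\<close> plays no role.\<close>

definition ergodic_sequence :: "'a measure \<Rightarrow> (nat \<Rightarrow> 'a \<Rightarrow> 'a) \<Rightarrow> bool" where
  "ergodic_sequence M T \<longleftrightarrow>
     prob_space M \<and> (\<forall>n\<ge>1. measure_preserving M (T n)) \<and>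
     (\<forall>\<phi>. square_integrable M \<phi> \<longrightarrow>
        (\<lambda>N. L2_norm M (\<lambda>x. 1 / of_nat N * (\<Sum>n=1..N. \<phi> (T n x)) - (LINT y|M. \<phi> y)))
          \<longlonglongrightarrow> 0)"

end

theory Submission
  imports Defs "HOL-Real_Asymp.Real_Asymp"
begin

text \<open>
  By density of trigonometric polynomials in \<open>L\<^sup>2\<close>, ergodicity only has to be tested on \<open>\<phi> z = z\<^sup>l\<close> with
  \<open>l \<ge> 1\<close>. Writing \<open>T\<^sub>n\<close> for the boundary map of \<open>G\<^sub>n\<close>, the squared norm of the average of the
  unimodular functions \<open>T\<^sub>n\<^sup>l\<close> is \<open>1/N\<close> plus twice the real part of the averaged correlations
  \<open>\<integral> T\<^sub>n\<^sup>l cnj (T\<^sub>m\<^sup>l)\<close>, \<open>m < n\<close>. If \<open>h\<close> is the composition of \<open>g\<^sub>m\<^sub>+\<^sub>1, \<dots>, g\<^sub>n\<close> then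
  \<open>T\<^sub>n\<close> is the boundary map of \<open>h\<close> composed with \<open>T\<^sub>m\<close>, which preserves the measure, so that the
  correlation is the \<open>l\<close>-th Taylor coefficient of \<open>h\<^sup>l\<close>, namely \<open>h'(0)\<^sup>l\<close>.

  Fatou's theorem is needed to know that compositions of inner functions are inner. It is obtained
  by applying a derivative kernel to the Lipschitz primitive of the bounded function, whose boundary
  values are differentiable almost everywhere by Lebesgue's differentiation theorem.
\<close>

section \<open>Integration over the unit circle\<close>

text \<open>The obstacle is the composition law for boundary maps. As r tends to 1, g (r * z) runs
  to its limit along a curve, on which the radial limits of h say nothing. Even the existence of
  unimodular radial limits of \<open>h \<circ> g\<close> has to be earned: Fatou's theorem yields
  some limit U with |U| \<le> 1, and U is then identified by integrals alone. This fixes the order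
  of the argument. Measure preservation must precede the composition law, because
  \<open>boundary_map h\<close> is known only off a null set and evaluating it at
  \<open>boundary_map g z\<close> makes sense only if preimages of null sets are null. It needs
  nothing but the moments of a single boundary map, which vanish by the mean value property and g 0
  = 0. The real part in the criterion appears because the correlations of (m, n) and (n, m) are
  conjugate; the diagonal contributes N terms out of N^2. The power of the derivative appears
  because h has a zero at 0: (h z / z)^l has boundary values H^l times cnj z^l, where H is the
  boundary map of h, and mean value h'(0)^l.\<close>

abbreviation borel_circle :: "complex measure" where
  "borel_circle \<equiv> distr (uniform_measure lborel {0..<2 * pi}) (restrict_space borel (sphere 0 1)) cis"

lemma cis_measurable_circle [measurable]: "cis \<in> uniform_measure lborel {0..<2 * pi} \<rightarrow>\<^sub>M restrict_space borel (sphere 0 1)"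
proof -
  have "cis \<in> borel_measurable borel"
    by (intro borel_measurable_continuous_onI continuous_intros)
  then show ?thesis
    by (intro measurable_restrict_space2) auto
qed

interpretation circ: prob_space circle_measure
  by (rule prob_space_circle_measure)

interpretation circ: complete_measure circle_measure
  unfolding circle_measure_def by (rule completion.complete_measure_axioms)

lemma borel_measurable_circleI:
  "f \<in> borel_measurable (restrict_space borel (sphere 0 1)) \<Longrightarrow> f \<in> borel_measurable circle_measure"
  unfolding circle_measure_def by (rule measurable_completion) simp

lemma continuous_on_circle_measurable:
  fixes f :: "complex \<Rightarrow> 'b :: topological_space"
  shows "continuous_on (sphere 0 1) f \<Longrightarrow> f \<in> borel_measurable circle_measure"
  by (intro borel_measurable_circleI borel_measurable_continuous_on_restrict)

lemma Arg2pi_borel_measurable [measurable]: "Arg2pi \<in> borel_measurable borel"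
  by (rule borel_measurableI_greater) (simp add: open_Arg2pi2pi_gt borel_open)

lemma cis_Arg2pi: "norm z = 1 \<Longrightarrow> cis (Arg2pi z) = z"
  using complex_norm_eq_1_exp[of z] by (simp add: cis_conv_exp)

lemma Arg2pi_cis: "0 \<le> t \<Longrightarrow> t < 2 * pi \<Longrightarrow> Arg2pi (cis t) = t"
  using Arg2pi_exp[of "\<i> * t"] by (simp add: cis_conv_exp)

text \<open>The set where the property fails need not be measurable, so that it is covered by a preimage
  under \<open>Arg2pi\<close>, a Borel inverse of \<open>cis\<close>.\<close>

lemma AE_circleI:
  assumes "AE t in lborel. 0 < t \<and> t < 2 * pi \<longrightarrow> P (cis t)"
  shows "AE z in circle_measure. P z"
proof -
  \<comment> \<open>The assumption concerns the open interval, where two-sided derivatives live; the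
    endpoint 0 is discarded as a null set.\<close>
  have "AE t in lborel. t \<noteq> 0" by (rule AE_lborel_singleton)
  with assms have "AE t in lborel. 0 \<le> t \<and> t < 2 * pi \<longrightarrow> P (cis t)" by eventually_elim auto
  then obtain N where N: "{t. \<not> (0 \<le> t \<and> t < 2 * pi \<longrightarrow> P (cis t))} \<subseteq> N" "N \<in> null_sets lborel"
    by (auto elim!: AE_E simp: null_sets_def)
  define S where "S = {z \<in> sphere 0 1. Arg2pi z \<in> N}"
  have Nm [measurable]: "N \<in> sets borel" using N by (auto simp: null_sets_def)
  have Sm: "S \<in> sets (restrict_space borel (sphere 0 1))"
  proof -
    have "{z. Arg2pi z \<in> N} \<in> sets borel" by measurable
    moreover have "S = {z. Arg2pi z \<in> N} \<inter> sphere 0 1" by (auto simp: S_def)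
    ultimately show ?thesis by (auto simp: sets_restrict_space)
  qed
  have "emeasure borel_circle S = emeasure (uniform_measure lborel {0..<2 * pi}) (cis -` S \<inter> UNIV)"
    using Sm by (subst emeasure_distr) auto
  also have "\<dots> \<le> emeasure lborel ({0..<2*pi} \<inter> cis -` S) / emeasure lborel {0..<2*pi}"
  proof (subst emeasure_uniform_measure)
    show "cis -` S \<inter> UNIV \<in> sets lborel"
      using measurable_sets[OF cis_measurable_circle Sm] by simp
  qed auto
  also have "emeasure lborel ({0..<2*pi} \<inter> cis -` S) = 0"
  proof -
    have "{0..<2*pi} \<inter> cis -` S \<subseteq> N" by (auto simp: S_def Arg2pi_cis)
    moreover have "{0..<2*pi} \<inter> cis -` S \<in> sets lborel"
      using measurable_sets[OF cis_measurable_circle Sm] by simp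
    ultimately have "{0..<2*pi} \<inter> cis -` S \<in> null_sets lborel"
      using N(2) null_sets_subset by blast
    then show ?thesis by auto
  qed
  finally have "S \<in> null_sets borel_circle" using Sm by (auto simp: null_sets_def)
  then have "AE z in borel_circle. z \<notin> S" by (rule AE_not_in)
  then have "AE z in borel_circle. P z"
  proof (rule AE_mp, intro AE_I2 impI)
    fix z assume "z \<in> space borel_circle" "z \<notin> S"
    then have z: "norm z = 1" "Arg2pi z \<notin> N" by (auto simp: S_def space_restrict_space)
    then have "P (cis (Arg2pi z))" using N(1) Arg2pi[of z] by auto
    then show "P z" using z by (simp add: cis_Arg2pi)
  qed
  then show ?thesis unfolding circle_measure_def by (simp add: AE_completion)
qed

lemma AE_circleD:
  assumes "AE z in circle_measure. P z"
  shows "AE t in lborel. 0 \<le> t \<and> t < 2 * pi \<longrightarrow> P (cis t)"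
proof -
  have "AE z in borel_circle. P z"
    using assms unfolding circle_measure_def by (simp add: AE_completion_iff)
  then have "AE t in uniform_measure lborel {0..<2 * pi}. P (cis t)"
    by (rule AE_distrD[OF cis_measurable_circle])
  then show ?thesis
    by (subst (asm) AE_uniform_measure) auto
qed

lemma AE_norm_one: "AE z in circle_measure. norm z = 1"
  by (rule AE_I2) (simp add: space_circle_measure)

lemma borel_measurable_cnj [measurable (raw)]:
  assumes "f \<in> borel_measurable M"
  shows "(\<lambda>x. cnj (f x)) \<in> borel_measurable M"
proof -
  have "cnj \<in> borel_measurable borel"
    by (intro borel_measurable_continuous_onI continuous_intros)
  then show ?thesis using measurable_compose[OF assms] by blast
qed

lemma integral_circle:
  fixes f :: "complex \<Rightarrow> complex"
  assumes "continuous_on (sphere 0 1) f"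
  shows "(LINT z|circle_measure. f z) = integral {0..2*pi} (\<lambda>t. f (cis t)) / (2 * pi)"
proof -
  have fm: "f \<in> borel_measurable (restrict_space borel (sphere 0 1))"
    using assms by (rule borel_measurable_continuous_on_restrict)
  have cont: "continuous_on A (\<lambda>t. f (cis t))" for A
    by (rule continuous_on_compose2[OF assms]) (auto intro!: continuous_intros)
  have m: "(\<lambda>t. f (cis t)) \<in> borel_measurable lborel"
    using borel_measurable_continuous_onI[OF cont] by simp
  have "(LINT z|circle_measure. f z) = (LINT z|borel_circle. f z)"
    unfolding circle_measure_def by (rule integral_completion) (use fm in simp)
  also have "\<dots> = (LINT t|uniform_measure lborel {0..<2 * pi}. f (cis t))"
    using fm by (intro integral_distr) auto
  also have "\<dots> = (LINT t|density lborel (\<lambda>t. ennreal (indicator {0..<2*pi} t / (2*pi))). f (cis t))"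
    unfolding uniform_measure_def
    by (rule arg_cong[where f="\<lambda>M. lebesgue_integral M _"], rule density_cong)
       (auto simp: indicator_def ennreal_1 divide_ennreal[symmetric] divide_ennreal_def inverse_ennreal)
  also have "\<dots> = (LINT t|lborel. (indicator {0..<2*pi} t / (2*pi)) *\<^sub>R f (cis t))"
    using m by (subst integral_density) auto
  \<comment> \<open>The interval is closed up at the null point \<open>2 * pi\<close> so that the
    integral can be read as a gauge integral over a compact interval.\<close>
  also have "\<dots> = (LINT t|lborel. (indicator {0..2*pi} t *\<^sub>R f (cis t)) / (2*pi))"
  proof (rule integral_cong_AE)
    have "AE t in lborel. t \<noteq> 2 * pi" by (rule AE_lborel_singleton)
    then show "AE t in lborel. (indicator {0..<2*pi} t / (2*pi)) *\<^sub>R f (cis t) = (indicator {0..2*pi} t *\<^sub>R f (cis t)) / (2*pi)"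
      by eventually_elim (auto simp: indicator_def scaleR_conv_of_real field_simps)
  qed (use m in measurable)
  also have "\<dots> = (LINT t:{0..2*pi}|lborel. f (cis t)) / (2*pi)"
    by (simp add: set_lebesgue_integral_def)
  also have "(LINT t:{0..2*pi}|lborel. f (cis t)) = integral {0..2*pi} (\<lambda>t. f (cis t))"
    by (rule set_borel_integral_eq_integral) (rule borel_integrable_atLeastAtMost', rule cont)
  finally show ?thesis .
qed

text \<open>On the circle dz = \<i> z dt, which accounts for the division by z and by
  \<open>2 * pi * \<i>\<close>.\<close>

lemma integral_circle_contour:
  fixes f :: "complex \<Rightarrow> complex"
  assumes "continuous_on (sphere 0 1) f"
  shows "(LINT z|circle_measure. f z) = contour_integral (circlepath 0 1) (\<lambda>z. f z / z) / (2 * pi * \<i>)"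
proof -
  have "contour_integral (circlepath 0 1) (\<lambda>z. f z / z) = integral {0..2*pi} (\<lambda>t. f (cis t) / cis t * (1 * \<i> * cis t))"
    unfolding circlepath_def
    by (subst contour_integral_part_circlepath_eq) (auto simp: algebra_simps)
  also have "\<dots> = integral {0..2*pi} (\<lambda>t. f (cis t) * \<i>)"
    by (intro integral_cong) simp
  finally show ?thesis using integral_circle[OF assms] by simp
qed

lemma integrable_circle:
  fixes f :: "complex \<Rightarrow> 'b::{banach, second_countable_topology}"
  assumes "f \<in> borel_measurable circle_measure" "AE z in circle_measure. norm (f z) \<le> B"
  shows "integrable circle_measure f"
  using assms by (intro circ.integrable_const_bound) auto

lemma integrable_circle_continuous:
  fixes f :: "complex \<Rightarrow> 'b::{banach, second_countable_topology}"
  assumes "continuous_on (sphere 0 1) f"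
  shows "integrable circle_measure f"
proof -
  have "compact (f ` sphere 0 1)" by (intro compact_continuous_image assms) auto
  then obtain B where "\<And>z. z \<in> sphere 0 1 \<Longrightarrow> norm (f z) \<le> B"
    using compact_imp_bounded bounded_iff by (metis imageI)
  then show ?thesis
    by (intro integrable_circle[where B=B] continuous_on_circle_measurable assms)
       (auto intro!: AE_I2 simp: space_circle_measure)
qed

lemma circle_Cauchy_integral:
  assumes c: "continuous_on (cball 0 1) f" and h: "f holomorphic_on ball 0 1" and w: "norm w < 1"
  shows "(LINT z|circle_measure. f z * z / (z - w)) = f w"
proof -
  have c1: "continuous_on (sphere 0 1) f" by (rule continuous_on_subset[OF c]) auto
  have "(LINT z|circle_measure. f z * z / (z - w)) =
      contour_integral (circlepath 0 1) (\<lambda>z. f z * z / (z - w) / z) / (2 * pi * \<i>)"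
    using w by (intro integral_circle_contour continuous_intros c1) auto
  also have "contour_integral (circlepath 0 1) (\<lambda>z. f z * z / (z - w) / z) =
      contour_integral (circlepath 0 1) (\<lambda>z. f z / (z - w))"
    by (intro contour_integral_cong) auto
  also have "\<dots> = 2 * of_real pi * \<i> * f w"
    by (rule contour_integral_unique, rule Cauchy_integral_circlepath) (use assms in auto)
  finally show ?thesis by simp
qed

lemma circle_mean_value:
  assumes "continuous_on (cball 0 1) f" and "f holomorphic_on ball 0 1"
  shows "(LINT z|circle_measure. f z) = f 0"
proof -
  have "(LINT z|circle_measure. f z) = (LINT z|circle_measure. f z * z / (z - 0))"
    by (intro Bochner_Integration.integral_cong) (auto simp: space_circle_measure)
  also have "\<dots> = f 0" by (rule circle_Cauchy_integral) (use assms in auto)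
  finally show ?thesis .
qed

section \<open>Radial limits of bounded holomorphic functions\<close>

definition taylor_coeff :: "(complex \<Rightarrow> complex) \<Rightarrow> nat \<Rightarrow> complex" where
  "taylor_coeff F n = (deriv ^^ n) F 0 / fact n"

lemma taylor_sums:
  assumes "F holomorphic_on ball 0 1" "norm w < 1"
  shows "(\<lambda>n. taylor_coeff F n * w ^ n) sums F w"
  using holomorphic_power_series[of F 0 1 w] assms by (simp add: taylor_coeff_def)

text \<open>F need not extend to the closed disc, so Cauchy's inequality is applied on radius r < 1
  and then r tends to 1.\<close>

lemma norm_taylor_coeff_le:
  assumes F: "F holomorphic_on ball 0 1" and B: "\<And>w. norm w < 1 \<Longrightarrow> norm (F w) \<le> B"
  shows "norm (taylor_coeff F n) \<le> B"
proof (rule tendsto_lowerbound)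
  show "((\<lambda>r. B / r ^ n) \<longlongrightarrow> B) (at_left (1::real))"
    by (auto intro!: tendsto_eq_intros)
  have "\<forall>\<^sub>F r in at_left (1::real). 0 < r \<and> r < 1"
    using eventually_at_left_real[of 0 1] by auto
  then show "\<forall>\<^sub>F r in at_left (1::real). norm (taylor_coeff F n) \<le> B / r ^ n"
  proof eventually_elim
    case (elim r)
    have "norm ((deriv ^^ n) F 0) \<le> fact n * B / r ^ n"
    proof (rule Cauchy_inequality)
      show "F holomorphic_on ball 0 r" by (rule holomorphic_on_subset[OF F]) (use elim in auto)
      show "continuous_on (cball 0 r) F"
        by (rule continuous_on_subset[OF holomorphic_on_imp_continuous_on[OF F]]) (use elim in auto)
    qed (use elim B in auto)
    then show ?case using elim by (simp add: taylor_coeff_def norm_divide field_simps)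
  qed
qed auto

lemma summable_taylor:
  assumes F: "F holomorphic_on ball 0 1" and B: "\<And>w. norm w < 1 \<Longrightarrow> norm (F w) \<le> B"
    and s: "norm s < 1"
  shows "summable (\<lambda>n. norm (taylor_coeff F n * s ^ n))"
proof (rule summable_comparison_test')
  show "summable (\<lambda>n. B * norm s ^ n)" using s by (intro summable_mult summable_geometric) auto
  show "norm (norm (taylor_coeff F n * s ^ n)) \<le> B * norm s ^ n" for n
    using norm_taylor_coeff_le[OF F B] by (auto simp: norm_mult norm_power intro!: mult_right_mono)
qed

lemma norm_dilate_less:
  fixes z :: complex
  assumes "norm r < 1" "norm z \<le> 1" shows "norm (r * z) < 1"
proof -
  have "norm r * norm z \<le> norm r * 1" using assms by (intro mult_left_mono) auto
  then show ?thesis using assms by (simp add: norm_mult)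
qed

lemma continuous_on_dilate:
  assumes F: "F holomorphic_on ball 0 1" and r: "norm r < 1"
  shows "continuous_on (cball 0 1) (\<lambda>z. F (r * z))"
  by (rule continuous_on_compose2[OF holomorphic_on_imp_continuous_on[OF F]])
     (use norm_dilate_less[OF r] in \<open>auto intro!: continuous_intros\<close>)

lemma holomorphic_on_dilate:
  assumes F: "F holomorphic_on ball 0 1" and r: "norm r < 1"
  shows "(\<lambda>z. F (r * z)) holomorphic_on ball 0 1"
  by (rule holomorphic_on_compose_gen[of "(*) r" _ F "ball 0 1", unfolded o_def, OF _ F])
     (use r in \<open>auto intro!: holomorphic_intros norm_dilate_less\<close>)

lemma cnj_eq_inverse_circle: "norm z = 1 \<Longrightarrow> cnj z = 1 / z"
  by (metis complex_cnj_cnj complex_mult_cnj complex_norm_square div_by_1 mult.commute nonzero_eq_divide_eq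
      norm_eq_zero of_real_1 one_power2 zero_neq_one)

lemma integral_dilate_coeff:
  assumes F: "F holomorphic_on ball 0 1" and r: "norm r < 1"
  shows "(LINT z|circle_measure. F (r * z) * cnj z ^ n) = taylor_coeff F n * r ^ n"
proof -
  let ?G = "\<lambda>z. F (r * z)"
  have c: "continuous_on (sphere 0 1) ?G"
    by (rule continuous_on_subset[OF continuous_on_dilate[OF F r]]) auto
  have "(LINT z|circle_measure. ?G z * cnj z ^ n) =
      contour_integral (circlepath 0 1) (\<lambda>z. ?G z * cnj z ^ n / z) / (2 * pi * \<i>)"
    by (intro integral_circle_contour continuous_intros c)
  also have "contour_integral (circlepath 0 1) (\<lambda>z. ?G z * cnj z ^ n / z) =
      contour_integral (circlepath 0 1) (\<lambda>z. ?G z / (z - 0) ^ Suc n)"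
    by (intro contour_integral_cong) (auto simp: cnj_eq_inverse_circle power_one_over field_simps)
  also have "\<dots> = (2 * pi * \<i>) * (deriv ^^ n) ?G 0 / fact n"
    by (rule Cauchy_contour_integral_circlepath)
       (use continuous_on_dilate[OF F r] holomorphic_on_dilate[OF F r] in auto)
  also have "(deriv ^^ n) ?G 0 = r ^ n * (deriv ^^ n) F (r * 0)"
    by (rule higher_deriv_compose_linear[OF F, where S="ball 0 1"]) (auto intro!: norm_dilate_less r)
  finally show ?thesis by (simp add: taylor_coeff_def)
qed

text \<open>Stated for a bounded U and a unimodular T because of two uses: the identity as T gives
  Parseval for dilations, a boundary map as T gives the comparison of moments for compositions. The
  factor s < 1 dominates the series by a convergent geometric one, which permits integration term by
  term.\<close>

lemma sums_integral_taylor: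
  fixes s :: real and U T :: "complex \<Rightarrow> complex"
  assumes F: "F holomorphic_on ball 0 1" and B: "\<And>w. norm w < 1 \<Longrightarrow> norm (F w) \<le> B"
    and s: "0 \<le> s" "s < 1"
    and Um: "U \<in> borel_measurable circle_measure" and U: "AE z in circle_measure. norm (U z) \<le> C"
    and Tm: "T \<in> borel_measurable circle_measure" and T: "\<And>z. norm z = 1 \<Longrightarrow> norm (T z) = 1"
  shows "(\<lambda>n. cnj (taylor_coeff F n) * s ^ n * (LINT z|circle_measure. U z * cnj (T z) ^ n)) sums
      (LINT z|circle_measure. U z * cnj (F (s * T z)))"
proof -
  define a where "a = taylor_coeff F"
  let ?f = "\<lambda>n z. U z * cnj (a n * (s * T z) ^ n)"
  note [measurable] = Um Tm
  have sm: "summable (\<lambda>n. norm (a n * of_real s ^ n))"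
    using summable_taylor[OF F B, of "of_real s"] s by (auto simp: a_def)
  note sp = AE_norm_one
  have nb: "norm (?f n z) \<le> C * norm (a n * of_real s ^ n)" if "norm z = 1" "norm (U z) \<le> C" for n z
  proof -
    have "norm (?f n z) = norm (U z) * norm (a n * of_real s ^ n)"
      using T[OF that(1)] by (simp add: norm_mult norm_power)
    then show ?thesis using mult_right_mono[OF that(2) norm_ge_zero] by metis
  qed
  have nbA: "AE z in circle_measure. norm (?f n z) \<le> C * norm (a n * of_real s ^ n)" for n
    using sp U by eventually_elim (rule nb)
  have int: "integrable circle_measure (?f n)" for n
    by (rule integrable_circle[OF _ nbA]) measurable
  have "(\<lambda>n. LINT z|circle_measure. ?f n z) sums (LINT z|circle_measure. (\<Sum>n. ?f n z))"
  proof (rule sums_integral[OF int])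
    show "AE z in circle_measure. summable (\<lambda>n. norm (?f n z))"
      using sp U
    proof eventually_elim
      case (elim z)
      show ?case
        by (rule summable_comparison_test'[OF summable_mult[OF sm, of C], of 0])
           (simp only: real_norm_def abs_norm_cancel nb[OF elim])
    qed
    show "summable (\<lambda>n. LINT z|circle_measure. norm (?f n z))"
    proof (rule summable_comparison_test'[OF summable_mult[OF sm, of C]])
      fix n
      have "(LINT z|circle_measure. norm (?f n z)) \<le> (LINT z|circle_measure. C * norm (a n * of_real s ^ n))"
        by (rule integral_mono_AE[OF integrable_norm[OF int] _ nbA]) simp
      then show "norm (LINT z|circle_measure. norm (?f n z)) \<le> C * norm (a n * of_real s ^ n)"
        by (simp add: circ.prob_space)
    qed
  qed
  also have "(LINT z|circle_measure. (\<Sum>n. ?f n z)) = (LINT z|circle_measure. U z * cnj (F (s * T z)))"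
  proof (intro Bochner_Integration.integral_cong refl)
    fix z assume "z \<in> space circle_measure"
    then have "norm (T z) = 1" by (intro T) (simp add: space_circle_measure)
    then have "(\<lambda>n. a n * (s * T z) ^ n) sums F (s * T z)"
      unfolding a_def using s by (intro taylor_sums F norm_dilate_less) auto
    have "(\<lambda>n. ?f n z) sums (U z * cnj (F (s * T z)))"
      by (intro sums_mult sums_cnj[THEN iffD2]) fact
    then show "(\<Sum>n. ?f n z) = U z * cnj (F (s * T z))" by (rule sums_unique[symmetric])
  qed
  also have "(\<lambda>n. LINT z|circle_measure. ?f n z) =
      (\<lambda>n. cnj (a n) * s ^ n * (LINT z|circle_measure. U z * cnj (T z) ^ n))"
  proof
    fix n
    have "(LINT z|circle_measure. ?f n z) = (LINT z|circle_measure. (cnj (a n) * s ^ n) * (U z * cnj (T z) ^ n))"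
      by (intro Bochner_Integration.integral_cong) (auto simp: power_mult_distrib)
    then show "(LINT z|circle_measure. ?f n z) = cnj (a n) * s ^ n * (LINT z|circle_measure. U z * cnj (T z) ^ n)"
      by simp
  qed
  finally show ?thesis by (simp add: a_def)
qed

text \<open>Parseval with two different radii: the mixed term in the squared distance of two
  dilations.\<close>

lemma integral_dilate_product:
  fixes r s :: real
  assumes F: "F holomorphic_on ball 0 1" and B: "\<And>w. norm w < 1 \<Longrightarrow> norm (F w) \<le> B"
    and r: "0 \<le> r" "r < 1" and s: "0 \<le> s" "s < 1"
  shows "(\<lambda>n. norm (taylor_coeff F n) ^ 2 * (r * s) ^ n) sums
      Re (LINT z|circle_measure. F (r * z) * cnj (F (s * z)))"
proof -
  have rn: "norm (complex_of_real r) < 1" using r by simp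
  have c: "continuous_on (sphere 0 1) (\<lambda>z::complex. F (r * z))"
    by (rule continuous_on_subset[OF continuous_on_dilate[OF F rn]]) auto
  have "(\<lambda>n. cnj (taylor_coeff F n) * s ^ n * (LINT z|circle_measure. F (r * z) * cnj z ^ n)) sums
      (LINT z|circle_measure. F (r * z) * cnj (F (s * z)))"
  proof (rule sums_integral_taylor[OF F B s])
    show "AE z in circle_measure. norm (F (r * z)) \<le> B"
      using AE_norm_one by eventually_elim (intro B norm_dilate_less rn, simp)
    show "(\<lambda>z. F (r * z)) \<in> borel_measurable circle_measure" "(\<lambda>z. z) \<in> borel_measurable circle_measure"
      by (intro continuous_on_circle_measurable c continuous_intros)+
  qed auto
  then have "(\<lambda>n. Re (cnj (taylor_coeff F n) * s ^ n * (taylor_coeff F n * of_real r ^ n))) sums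
      Re (LINT z|circle_measure. F (r * z) * cnj (F (s * z)))"
    unfolding integral_dilate_coeff[OF F rn] by (rule sums_Re)
  also have "(\<lambda>n. Re (cnj (taylor_coeff F n) * s ^ n * (taylor_coeff F n * of_real r ^ n))) =
      (\<lambda>n. norm (taylor_coeff F n) ^ 2 * (r * s) ^ n)"
  proof
    fix n
    have "cnj (taylor_coeff F n) * s ^ n * (taylor_coeff F n * of_real r ^ n) =
        (taylor_coeff F n * cnj (taylor_coeff F n)) * of_real ((r * s) ^ n)"
      by (simp add: power_mult_distrib mult_ac)
    also have "\<dots> = of_real (norm (taylor_coeff F n) ^ 2 * (r * s) ^ n)"
      by (simp only: complex_norm_square of_real_mult)
    finally show "Re (cnj (taylor_coeff F n) * s ^ n * (taylor_coeff F n * of_real r ^ n)) =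
        norm (taylor_coeff F n) ^ 2 * (r * s) ^ n"
      by (simp only: Re_complex_of_real)
  qed
  finally show ?thesis .
qed

text \<open>Nonnegativity of the variance of |f|. It turns the L2 Cauchy property of the dilations
  into an L1 one, from which an almost everywhere Cauchy subsequence can be extracted.\<close>

lemma circle_integral_norm_le_sqrt:
  fixes f :: "complex \<Rightarrow> complex"
  assumes "continuous_on (sphere 0 1) f"
  shows "(LINT z|circle_measure. norm (f z)) \<le> sqrt (LINT z|circle_measure. norm (f z) ^ 2)"
proof -
  have i: "integrable circle_measure (\<lambda>z. norm (f z))" "integrable circle_measure (\<lambda>z. norm (f z) ^ 2)"
    by (intro integrable_circle_continuous continuous_intros assms)+
  have "circ.variance (\<lambda>z. norm (f z)) \<ge> 0" by (rule circ.variance_positive)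
  then show ?thesis
    by (subst (asm) circ.variance_eq) (use i in \<open>auto intro: real_le_rsqrt\<close>)
qed

lemma cmod_diff_squared: "norm (x - y :: complex) ^ 2 = norm x ^ 2 + norm y ^ 2 - 2 * Re (x * cnj y)"
  unfolding cmod_power2 by (simp add: algebra_simps power2_eq_square)

text \<open>With \<open>A x = \<Sum>n. \<bar>a\<^sub>n\<bar>\<^sup>2 x\<^sup>n\<close>, the squared \<open>L\<^sup>2\<close> distance of the dilations by \<open>s \<le> r\<close> is
  \<open>A (r\<^sup>2) + A (s\<^sup>2) - 2 A (r s) \<le> A (r\<^sup>2) - A (s\<^sup>2)\<close>, and \<open>A\<close> is monotone and bounded on \<open>[0, 1)\<close>.\<close>

lemma radial_AE_convergent_sequence:
  assumes F: "F holomorphic_on ball 0 1" and B: "\<And>w. norm w < 1 \<Longrightarrow> norm (F w) \<le> B"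
  obtains \<rho> :: "nat \<Rightarrow> real" where "\<And>i. 0 \<le> \<rho> i" "\<And>i. \<rho> i < 1" "\<rho> \<longlonglongrightarrow> 1"
    "AE z in circle_measure. convergent (\<lambda>i. F (\<rho> i * z))"
proof -
  define q :: "nat \<Rightarrow> real" where "q i = 1 - 1 / (real i + 1)" for i
  define A where "A x = (\<Sum>n. norm (taylor_coeff F n) ^ 2 * x ^ n)" for x :: real
  have q: "0 \<le> q i" "q i < 1" for i by (auto simp: q_def field_simps)
  have q_mono: "i \<le> j \<Longrightarrow> q i \<le> q j" for i j by (auto simp: q_def field_simps)
  have q_lim: "q \<longlonglongrightarrow> 1" unfolding q_def by real_asymp
  have c: "continuous_on (sphere 0 1) (\<lambda>z::complex. F (q i * z))" for i
    by (rule continuous_on_subset[OF continuous_on_dilate[OF F]]) (use q[of i] in auto)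
  have A: "Re (LINT z|circle_measure. F (q i * z) * cnj (F (q j * z))) = A (q i * q j)" for i j
    using integral_dilate_product[OF F B q q] by (simp add: A_def sums_iff)
  have Asum: "summable (\<lambda>n. norm (taylor_coeff F n) ^ 2 * (q i * q j) ^ n)" for i j
    using integral_dilate_product[OF F B q q] by (simp add: sums_iff)
  have sq: "(LINT z|circle_measure. norm (F (q i * z)) ^ 2) = A (q i * q i)" for i
  proof -
    have "A (q i * q i) = (LINT z|circle_measure. Re (F (q i * z) * cnj (F (q i * z))))"
      unfolding A[symmetric]
      by (rule integral_Re[symmetric]) (intro integrable_circle_continuous continuous_intros c)
    then show ?thesis by (simp add: complex_norm_square[symmetric] del: of_real_power)
  qed
  have diff: "(LINT z|circle_measure. norm (F (q i * z) - F (q j * z)) ^ 2) \<le> A (q i * q i) - A (q j * q j)"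
    if "j \<le> i" for i j
  proof -
    have "(LINT z|circle_measure. norm (F (q i * z) - F (q j * z)) ^ 2) =
       (LINT z|circle_measure. norm (F (q i * z)) ^ 2 + norm (F (q j * z)) ^ 2 - 2 * Re (F (q i * z) * cnj (F (q j * z))))"
      by (simp only: cmod_diff_squared)
    also have "\<dots> = (LINT z|circle_measure. norm (F (q i * z)) ^ 2) + (LINT z|circle_measure. norm (F (q j * z)) ^ 2)
        - 2 * (LINT z|circle_measure. Re (F (q i * z) * cnj (F (q j * z))))"
    proof -
      have "integrable circle_measure (\<lambda>z. norm (F (q i * z)) ^ 2)"
        "integrable circle_measure (\<lambda>z. norm (F (q j * z)) ^ 2)"
        "integrable circle_measure (\<lambda>z. Re (F (q i * z) * cnj (F (q j * z))))"
        by (intro integrable_circle_continuous continuous_intros c)+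
      then show ?thesis by (simp del: times_complex.sel)
    qed
    also have "(LINT z|circle_measure. Re (F (q i * z) * cnj (F (q j * z)))) = A (q i * q j)"
      unfolding A[symmetric]
      by (rule integral_Re) (intro integrable_circle_continuous continuous_intros c)
    finally have "(LINT z|circle_measure. norm (F (q i * z) - F (q j * z)) ^ 2) = A (q i * q i) + A (q j * q j) - 2 * A (q i * q j)"
      by (simp only: sq)
    moreover have "A (q i * q j) \<ge> A (q j * q j)"
      unfolding A_def
      by (intro suminf_le Asum mult_left_mono power_mono mult_right_mono q_mono that) (use q in auto)
    ultimately show ?thesis by linarith
  qed
  have "convergent (\<lambda>i. A (q i * q i))"
  proof (rule Bseq_mono_convergent)
    have "norm (A (q i * q i)) \<le> B ^ 2" for i
    proof -
      have "A (q i * q i) \<le> (LINT z|circle_measure. B ^ 2)"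
        unfolding sq[symmetric]
        by (intro integral_mono integrable_circle_continuous continuous_intros c)
           (use q in \<open>auto simp: space_circle_measure intro!: power_mono B norm_dilate_less\<close>)
      moreover have "A (q i * q i) \<ge> 0" unfolding sq[symmetric] by (rule Bochner_Integration.integral_nonneg) auto
      ultimately show ?thesis by (simp add: circ.prob_space)
    qed
    then show "Bseq (\<lambda>i. A (q i * q i))" by (rule BseqI')
    show "\<forall>m. \<forall>n\<ge>m. A (q m * q m) \<le> A (q n * q n)"
      unfolding A_def using q
      by (intro allI impI suminf_le Asum mult_left_mono power_mono mult_mono q_mono) auto
  qed
  then have Cau: "Cauchy (\<lambda>i. A (q i * q i))" by (simp add: Cauchy_convergent_iff)
  \<comment> \<open>Convergence in mean yields pointwise convergence along a subsequence only. This
    suffices, since the limit merely serves as the density of the boundary primitive.\<close>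
  obtain r where r: "strict_mono r" "AE z in circle_measure. Cauchy (\<lambda>i. F (q (r i) * z))"
  proof (rule cauchy_L1_AE_cauchy_subseq[where M=circle_measure and s="\<lambda>i z. F (q i * z)"])
    show "integrable circle_measure (\<lambda>z. F (q n * z))" for n
      by (intro integrable_circle_continuous c)
    fix e :: real assume "e > 0"
    then obtain N where N: "\<And>i j. i \<ge> N \<Longrightarrow> j \<ge> N \<Longrightarrow> norm (A (q i * q i) - A (q j * q j)) < e ^ 2"
      using CauchyD[OF Cau, of "e ^ 2"] by auto
    have *: "(LINT z|circle_measure. norm (F (q i * z) - F (q j * z))) < e" if "N \<le> j" "j \<le> i" for i j
    proof -
      have "(LINT z|circle_measure. norm (F (q i * z) - F (q j * z))) \<le>
          sqrt (LINT z|circle_measure. norm (F (q i * z) - F (q j * z)) ^ 2)"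
        by (intro circle_integral_norm_le_sqrt continuous_intros c)
      also have "\<dots> \<le> sqrt (A (q i * q i) - A (q j * q j))"
        using diff that by simp
      also have "\<dots> < sqrt (e ^ 2)"
        using N[of i j] that by (simp del: real_sqrt_abs)
      finally show ?thesis using \<open>e > 0\<close> by simp
    qed
    have "(LINT z|circle_measure. norm (F (q i * z) - F (q j * z))) < e" if "N \<le> j" "N \<le> i" for i j
      using *[of i j] *[of j i] that by (cases "j \<le> i") (auto simp: norm_minus_commute)
    then show "\<exists>N. \<forall>i\<ge>N. \<forall>j\<ge>N. (LINT z|circle_measure. norm (F (q i * z) - F (q j * z))) < e"
      by blast
  qed auto
  show ?thesis
  proof (rule that[of "q \<circ> r"])
    show "(q \<circ> r) \<longlonglongrightarrow> 1" using q_lim r(1) by (rule LIMSEQ_subseq_LIMSEQ)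
    show "AE z in circle_measure. convergent (\<lambda>i. F ((q \<circ> r) i * z))"
      using r(2) by (simp add: Cauchy_convergent_iff)
  qed (auto simp: q)
qed

section \<open>Differentiability of the boundary values of a primitive\<close>

lemma negligible_AE: "negligible N \<Longrightarrow> AE x in lborel. x \<notin> N"
  using AE_not_in[of N lebesgue] by (simp add: negligible_iff_null_sets AE_completion_iff)

lemma norm_difference_quotient:
  fixes v w :: "'a::real_normed_vector"
  assumes "h \<noteq> 0"
  shows "norm (v - h *\<^sub>R w) / \<bar>h\<bar> = norm (v /\<^sub>R h - w)"
proof -
  have "v /\<^sub>R h - w = (v - h *\<^sub>R w) /\<^sub>R h" using assms by (simp add: scaleR_diff_right)
  then show ?thesis by (simp add: divide_inverse mult.commute)
qed

lemma has_vector_derivative_difference_quotient: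
  assumes "(f has_vector_derivative D) (at t)"
  shows "((\<lambda>s. (f s - f t) /\<^sub>R (s - t)) \<longlongrightarrow> D) (at t)"
proof (rule tendstoI)
  fix e :: real assume "e > 0"
  with assms obtain d where d: "d > 0"
    "\<And>s. 0 < \<bar>s - t\<bar> \<Longrightarrow> \<bar>s - t\<bar> < d \<Longrightarrow> norm (f s - f t - (s - t) *\<^sub>R D) / \<bar>s - t\<bar> < e"
    unfolding has_vector_derivative_def has_derivative_at' by (metis real_norm_def)
  then show "\<forall>\<^sub>F s in at t. dist ((f s - f t) /\<^sub>R (s - t)) D < e"
    using norm_difference_quotient[of "s - t" "f s - f t" D for s]
    by (auto simp: eventually_at dist_norm intro!: exI[of _ d])
qed

lemma boundary_primitive_differentiable_AE:
  fixes \<Phi> F :: "complex \<Rightarrow> complex"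
  assumes F: "F holomorphic_on ball 0 1" and B: "\<And>w. norm w < 1 \<Longrightarrow> norm (F w) \<le> B"
    and \<Phi>c: "continuous_on (cball 0 1) \<Phi>"
    and \<Phi>d: "\<And>w. norm w < 1 \<Longrightarrow> (\<Phi> has_field_derivative F w) (at w)"
  shows "AE t in lborel. 0 < t \<and> t < 2 * pi \<longrightarrow> (\<exists>D. ((\<lambda>s. \<Phi> (cis s)) has_vector_derivative D) (at t))"
proof -
  obtain \<rho> :: "nat \<Rightarrow> real" where \<rho>: "\<And>i. 0 \<le> \<rho> i" "\<And>i. \<rho> i < 1" "\<rho> \<longlonglongrightarrow> 1"
    and AEc: "AE z in circle_measure. convergent (\<lambda>i. F (\<rho> i * z))"
    using radial_AE_convergent_sequence[OF F B] by metis
  have B0: "B \<ge> 0" using order_trans[OF norm_ge_zero B[of 0]] by simp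
  have \<rho>n: "norm (of_real (\<rho> i) * cis t) < 1" for i t
    using \<rho>(1,2)[of i] by (simp add: norm_mult)
  \<comment> \<open>This is the derivative in t of \<open>\<Phi> (\<rho> i * cis t)\<close>.\<close>
  define u where "u i t = F (\<rho> i * cis t) * (\<rho> i * \<i> * cis t)" for i t
  \<comment> \<open>The value 0 outside one period makes f integrable over the whole line.\<close>
  define f where "f t = (if t \<in> {0..<2*pi} then lim (\<lambda>i. u i t) else 0)" for t
  have uc: "continuous_on A (u i)" for A i
    unfolding u_def
    by (intro continuous_intros continuous_on_compose2[OF continuous_on_dilate[OF F, of "\<rho> i"]]) (use \<rho> in auto)
  have um [measurable]: "u i \<in> borel_measurable borel" for i
    by (rule borel_measurable_continuous_onI[OF uc])
  have fm [measurable]: "f \<in> borel_measurable borel"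
    unfolding f_def by measurable
  have ub: "norm (u i t) \<le> B" for i t
  proof -
    have "norm (u i t) = norm (F (\<rho> i * cis t)) * \<rho> i" using \<rho> by (simp add: u_def norm_mult)
    also have "\<dots> \<le> B * 1" using \<rho>(1,2)[of i] B0 \<rho>n
      by (intro mult_mono B) auto
    finally show ?thesis by simp
  qed
  have AEu: "AE t in lborel. t \<in> {0..<2*pi} \<longrightarrow> (\<lambda>i. u i t) \<longlonglongrightarrow> f t"
  proof -
    have "AE t in lborel. 0 \<le> t \<and> t < 2 * pi \<longrightarrow> convergent (\<lambda>i. F (\<rho> i * cis t))"
      by (rule AE_circleD[OF AEc])
    then show ?thesis
    proof eventually_elim
      case (elim t)
      show ?case
      proof
        assume t: "t \<in> {0..<2*pi}"
        then obtain l where l: "(\<lambda>i. F (\<rho> i * cis t)) \<longlonglongrightarrow> l" using elim by (auto simp: convergent_def)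
        have "(\<lambda>i. u i t) \<longlonglongrightarrow> l * (of_real 1 * \<i> * cis t)"
          unfolding u_def by (intro tendsto_intros l \<rho>)
        moreover from limI[OF this] have "f t = l * (of_real 1 * \<i> * cis t)" using t by (simp add: f_def)
        ultimately show "(\<lambda>i. u i t) \<longlonglongrightarrow> f t" by simp
      qed
    qed
  qed
  have AEf: "AE t in lborel. norm (f t) \<le> B"
    using AEu
  proof eventually_elim
    case (elim t)
    then show ?case
      using B0 ub by (cases "t \<in> {0..<2*pi}") (auto simp: f_def intro: LIMSEQ_le_const2[OF tendsto_norm] split: if_splits)
  qed
  have fint: "integrable lborel f"
  proof (rule integrableI_bounded_set[where A="{0..<2*pi}" and B=B])
    show "AE x in lborel. x \<in> {0..<2*pi} \<longrightarrow> norm (f x) \<le> B" using AEf by eventually_elim auto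
  qed (auto simp: f_def)
  have fint2: "f integrable_on cbox a b" for a b :: real
    using integrable_on_lborel[OF fint] by (rule integrable_on_subcbox) auto
  \<comment> \<open>The fundamental theorem of calculus holds on each circle of radius
    \<open>\<rho> i\<close>; the limit is taken by dominated convergence on one side and by
    continuity of \<Phi> up to the boundary on the other.\<close>
  have prim: "integral {a..b} f = \<Phi> (cis b) - \<Phi> (cis a)" if ab: "0 \<le> a" "a \<le> b" "b < 2 * pi" for a b
  proof -
    have ui: "(u i has_integral (\<Phi> (\<rho> i * cis b) - \<Phi> (\<rho> i * cis a))) {a..b}" for i
    proof (rule fundamental_theorem_of_calculus)
      fix t assume "t \<in> {a..b}"
      have "((\<lambda>t. of_real (\<rho> i) * cis t) has_vector_derivative (\<rho> i * \<i> * cis t)) (at t within {a..b})"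
        by (auto intro!: derivative_eq_intros simp: has_vector_derivative_def scaleR_conv_of_real mult_ac)
      from field_vector_diff_chain_within[OF this DERIV_subset[OF \<Phi>d]]
      have "((\<Phi> \<circ> (\<lambda>t. of_real (\<rho> i) * cis t)) has_vector_derivative (\<rho> i * \<i> * cis t * F (of_real (\<rho> i) * cis t))) (at t within {a..b})"
        using \<rho>n by blast
      then show "((\<lambda>t. \<Phi> (\<rho> i * cis t)) has_vector_derivative u i t) (at t within {a..b})"
        by (simp add: o_def u_def mult_ac)
    qed fact
    have "(\<lambda>i. LINT t:{a..b}|lborel. u i t) \<longlonglongrightarrow> (LINT t:{a..b}|lborel. f t)"
      unfolding set_lebesgue_integral_def
    proof (rule integral_dominated_convergence[where w="\<lambda>t. indicator {a..b} t * B"])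
      show "integrable lborel (\<lambda>t. indicat_real {a..b} t * B)"
        using ab by (intro integrable_mult_left integrable_real_indicator) auto
      show "AE t in lborel. (\<lambda>i. indicat_real {a..b} t *\<^sub>R u i t) \<longlonglongrightarrow> indicat_real {a..b} t *\<^sub>R f t"
        using AEu
      proof eventually_elim
        case (elim t)
        then show ?case using ab by (cases "t \<in> {a..b}") (auto intro!: tendsto_intros)
      qed
      show "AE t in lborel. norm (indicat_real {a..b} t *\<^sub>R u i t) \<le> indicat_real {a..b} t * B" for i
        using ub by (auto simp: indicator_def)
    qed auto
    moreover have "(LINT t:{a..b}|lborel. u i t) = \<Phi> (\<rho> i * cis b) - \<Phi> (\<rho> i * cis a)" for i
      using set_borel_integral_eq_integral(2)[OF borel_integrable_atLeastAtMost'[OF uc]] integral_unique[OF ui]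
      by simp
    moreover have "(LINT t:{a..b}|lborel. f t) = integral {a..b} f"
    proof (rule set_borel_integral_eq_integral)
      show "set_integrable lborel {a..b} f"
        unfolding set_integrable_def using fint by (intro integrable_mult_indicator) auto
    qed
    ultimately have l1: "(\<lambda>i. \<Phi> (\<rho> i * cis b) - \<Phi> (\<rho> i * cis a)) \<longlonglongrightarrow> integral {a..b} f" by simp
    have l2: "(\<lambda>i. \<Phi> (\<rho> i * cis c)) \<longlonglongrightarrow> \<Phi> (1 * cis c)" for c
    proof (rule continuous_on_tendsto_compose[OF \<Phi>c])
      have "(\<lambda>i. of_real (\<rho> i) * cis c) \<longlonglongrightarrow> of_real 1 * cis c" by (intro tendsto_intros \<rho>)
      then show "(\<lambda>i. of_real (\<rho> i) * cis c) \<longlonglongrightarrow> 1 * cis c" by simp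
    qed (use \<rho> in \<open>auto simp: norm_mult less_imp_le\<close>)
    have "(\<lambda>i. \<Phi> (\<rho> i * cis b) - \<Phi> (\<rho> i * cis a)) \<longlonglongrightarrow> \<Phi> (1 * cis b) - \<Phi> (1 * cis a)"
      by (intro tendsto_diff l2)
    from LIMSEQ_unique[OF l1 this] show ?thesis by simp
  qed
  \<comment> \<open>The differentiation theorem used below controls intervals to the right of a
    point; applied to the reflected function it also controls those to the left.\<close>
  have fr: "(\<lambda>x. f (- x)) integrable_on cbox a b" for a b :: real
    using fint2[of "-b" "-a"] Henstock_Kurzweil_Integration.integrable_reflect_real[where f=f and a="-b" and b="-a"] by simp
  obtain N where N: "negligible N"
    "\<And>x e. \<lbrakk>x \<notin> N; 0 < e\<rbrakk> \<Longrightarrow> \<exists>d>0. \<forall>h. 0 < h \<and> h < d \<longrightarrow> norm (integral {x..x+h} f /\<^sub>R h - f x) < e"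
    using integrable_ccontinuous_explicit[of f, OF fint2] by (auto simp: mult.commute)
  obtain N' where N': "negligible N'"
    "\<And>x e. \<lbrakk>x \<notin> N'; 0 < e\<rbrakk> \<Longrightarrow> \<exists>d>0. \<forall>h. 0 < h \<and> h < d \<longrightarrow> norm (integral {x..x+h} (\<lambda>x. f (- x)) /\<^sub>R h - f (- x)) < e"
    using integrable_ccontinuous_explicit[of "\<lambda>x. f (- x)", OF fr] by (auto simp: mult.commute)
  have deriv: "((\<lambda>s. \<Phi> (cis s)) has_vector_derivative f t) (at t)"
    if t: "0 < t" "t < 2 * pi" "t \<notin> N" "- t \<notin> N'" for t
    unfolding has_vector_derivative_def has_derivative_at'
  proof (intro conjI allI impI)
    fix e :: real assume e: "e > 0"
    obtain d1 where d1: "d1 > 0" "\<And>h. 0 < h \<Longrightarrow> h < d1 \<Longrightarrow> norm (integral {t..t+h} f /\<^sub>R h - f t) < e"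
      using N(2)[OF t(3) e] by auto
    obtain d2 where d2: "d2 > 0" "\<And>h. 0 < h \<Longrightarrow> h < d2 \<Longrightarrow> norm (integral {-t..-t+h} (\<lambda>x. f (- x)) /\<^sub>R h - f t) < e"
      using N'(2)[OF t(4) e] by auto
    \<comment> \<open>The bounds t and \<open>2 * pi - t\<close> keep the interval between t and x'
      inside the period, where \<open>prim\<close> applies.\<close>
    define d where "d = min (min d1 d2) (min t (2 * pi - t))"
    have d: "d > 0" "d \<le> d1" "d \<le> d2" "d \<le> t" "d \<le> 2 * pi - t" using t d1 d2 by (auto simp: d_def)
    note scale = norm_difference_quotient
    show "\<exists>d>0. \<forall>x'. 0 < norm (x' - t) \<and> norm (x' - t) < d \<longrightarrow>
        norm (\<Phi> (cis x') - \<Phi> (cis t) - (x' - t) *\<^sub>R f t) / norm (x' - t) < e"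
    proof (intro exI[of _ d] conjI allI impI d(1))
      fix x' assume x': "0 < norm (x' - t) \<and> norm (x' - t) < d"
      show "norm (\<Phi> (cis x') - \<Phi> (cis t) - (x' - t) *\<^sub>R f t) / norm (x' - t) < e"
      proof (cases "x' > t")
        case True
        define h where "h = x' - t"
        have h: "0 < h" "h < d" "x' = t + h" using True x' by (auto simp: h_def)
        have "integral {t..t+h} f = \<Phi> (cis x') - \<Phi> (cis t)"
          using prim[of t "t + h"] h d t by simp
        with d1(2)[of h] h d have "norm ((\<Phi> (cis x') - \<Phi> (cis t)) /\<^sub>R h - f t) < e" by auto
        with scale[of h "\<Phi> (cis x') - \<Phi> (cis t)" "f t"] h(1)
        have "norm (\<Phi> (cis x') - \<Phi> (cis t) - h *\<^sub>R f t) / \<bar>h\<bar> < e" by auto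
        then show ?thesis by (simp only: h_def real_norm_def)
      next
        case False
        define h where "h = t - x'"
        have h: "0 < h" "h < d" "x' = t - h" using False x' by (auto simp: h_def)
        have "integral {-t..-t+h} (\<lambda>x. f (- x)) = integral {t - h..t} f"
          using Henstock_Kurzweil_Integration.integral_reflect_real[of t "t - h" f] by simp
        also have "\<dots> = \<Phi> (cis t) - \<Phi> (cis x')"
          using prim[of "t - h" t] h d t by simp
        finally have "norm ((\<Phi> (cis t) - \<Phi> (cis x')) /\<^sub>R h - f t) < e"
          using d2(2)[of h] h d by simp
        then have "norm ((\<Phi> (cis t) - \<Phi> (cis x')) - h *\<^sub>R f t) / \<bar>h\<bar> < e"
          using scale[of h "\<Phi> (cis t) - \<Phi> (cis x')" "f t"] h(1) by auto
        also have "norm ((\<Phi> (cis t) - \<Phi> (cis x')) - h *\<^sub>R f t) = norm (\<Phi> (cis x') - \<Phi> (cis t) - (x' - t) *\<^sub>R f t)"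
        proof -
          have "\<Phi> (cis x') - \<Phi> (cis t) - (x' - t) *\<^sub>R f t = - ((\<Phi> (cis t) - \<Phi> (cis x')) - h *\<^sub>R f t)"
            by (simp add: h_def algebra_simps)
          then show ?thesis by (simp only: norm_minus_cancel)
        qed
        finally show ?thesis by (simp only: h_def real_norm_def abs_minus_commute)
      qed
    qed
  qed (rule bounded_linear_scaleR_left)
  have "AE t in lborel. t \<notin> N"
    using N(1) by (rule negligible_AE)
  moreover have "AE t in lborel. - t \<notin> N'"
  proof -
    have "negligible (uminus ` N')" 
      by (rule negligible_differentiable_image_negligible[OF order_refl N'(1)])
         (intro linear_imp_differentiable_on linear_uminus)
    then have "AE t in lborel. t \<notin> uminus ` N'" by (rule negligible_AE)
    then show ?thesis by eventually_elim force
  qed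
  ultimately show ?thesis
    by eventually_elim (auto intro: deriv)
qed

section \<open>The Poisson kernel, the reflected derivative kernel, and Fatou's theorem\<close>

lemma Poisson_kernel_integral:
  assumes w: "norm w < 1"
  shows "(LINT z|circle_measure. 1 / norm (z - w) ^ 2) = 1 / (1 - norm w ^ 2)"
proof -
  have nz: "1 - cnj w * z \<noteq> 0" if "norm z \<le> 1" for z
    using norm_dilate_less[of "cnj w" z] w that by auto
  \<comment> \<open>Cauchy's formula at w for the function \<open>1 / (1 - cnj w * z)\<close>; on
    the circle \<open>1 - cnj w * z\<close> equals \<open>z * cnj (z - w)\<close>, so that the
    integrand is 1 / |z - w|^2.\<close>
  have "(LINT z|circle_measure. 1 / (1 - cnj w * z) * z / (z - w)) = 1 / (1 - cnj w * w)"
    by (rule circle_Cauchy_integral[OF _ _ w]) (intro continuous_intros holomorphic_on_divide holomorphic_on_diff holomorphic_on_mult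
        holomorphic_on_const holomorphic_on_ident ballI nz, auto simp: nz)+
  also have "(LINT z|circle_measure. 1 / (1 - cnj w * z) * z / (z - w)) =
      (LINT z|circle_measure. of_real (1 / norm (z - w) ^ 2))"
  proof (intro Bochner_Integration.integral_cong refl)
    fix z assume "z \<in> space circle_measure"
    then have z: "norm z = 1" by (simp add: space_circle_measure)
    then have zz: "z * cnj z = 1" "z \<noteq> 0" by (auto simp: cnj_eq_inverse_circle)
    have "1 - cnj w * z = z * cnj (z - w)" using zz by (simp add: algebra_simps)
    then have "1 / (1 - cnj w * z) * z / (z - w) = 1 / ((z - w) * cnj (z - w))" using zz by simp
    then show "1 / (1 - cnj w * z) * z / (z - w) = of_real (1 / norm (z - w) ^ 2)"
      by (simp only: complex_norm_square of_real_divide of_real_1)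
  qed
  also have "\<dots> = of_real (LINT z|circle_measure. 1 / norm (z - w) ^ 2)" by (rule integral_complex_of_real)
  also have "1 / (1 - cnj w * w) = of_real (1 / (1 - norm w ^ 2))"
    by (simp only: complex_norm_square of_real_divide of_real_1 of_real_diff mult.commute)
  finally show ?thesis by (simp only: of_real_eq_iff)
qed

text \<open>The kernel \<open>1 / (z - w)\<^sup>2\<close> of Cauchy's formula is not integrable enough against \<open>\<bar>z - \<zeta>\<bar>\<close> as \<open>w\<close> tends
  to \<open>\<zeta>\<close>. Subtracting the same kernel at the reflected point \<open>v\<close> outside the disc gains a factor
  \<open>(1 - r) / \<bar>z - w\<bar>\<close>.\<close>

lemma deriv_eq_reflected_kernel_integral:
  assumes c: "continuous_on (cball 0 1) f" and h: "f holomorphic_on ball 0 1" and w: "norm w < 1"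
    and v: "norm v > 1"
  shows "deriv f w = (LINT z|circle_measure. f z * z * (1 / (z - w) ^ 2 - 1 / (z - v) ^ 2))"
proof -
  have c1: "continuous_on (sphere 0 1) f" by (rule continuous_on_subset[OF c]) auto
  have c2: "continuous_on (sphere 0 1) (\<lambda>z. f z * z / (z - w) ^ 2)"
    by (intro continuous_intros c1) (use w in auto)
  have nz: "z \<noteq> v" if "norm z \<le> 1" for z using that v by auto
  have c3: "continuous_on (cball 0 1) (\<lambda>z. f z * z / (z - v) ^ 2)"
    by (intro continuous_intros c) (use v in auto)
  have c4: "continuous_on (sphere 0 1) (\<lambda>z. f z * z / (z - v) ^ 2)" by (rule continuous_on_subset[OF c3]) auto
  have "deriv f w = 1 / (2 * of_real pi * \<i>) * contour_integral(circlepath 0 1) (\<lambda>u. f u / (u-w)^2)"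
    by (rule DERIV_imp_deriv, rule Cauchy_derivative_integral_circlepath) (use c h w in auto)
  also have "contour_integral(circlepath 0 1) (\<lambda>u. f u / (u-w)^2) = contour_integral(circlepath 0 1) (\<lambda>u. (f u * u / (u-w)^2) / u)"
    by (intro contour_integral_cong) auto
  also have "1 / (2 * of_real pi * \<i>) * \<dots> = (LINT z|circle_measure. f z * z / (z - w) ^ 2)"
    by (subst integral_circle_contour[OF c2]) simp
  \<comment> \<open>The subtracted integral is 0: its integrand is holomorphic in the disc since v
    lies outside, and the factor z makes it vanish at the centre.\<close>
  also have "\<dots> = (LINT z|circle_measure. f z * z / (z - w) ^ 2) - (LINT z|circle_measure. f z * z / (z - v) ^ 2)"
  proof -
    have "(LINT z|circle_measure. f z * z / (z - v) ^ 2) = f 0 * 0 / (0 - v) ^ 2"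
      by (rule circle_mean_value[OF c3]) (use nz in \<open>auto intro!: holomorphic_intros h\<close>)
    then show ?thesis by simp
  qed
  also have "\<dots> = (LINT z|circle_measure. f z * z / (z - w) ^ 2 - f z * z / (z - v) ^ 2)"
    by (rule Bochner_Integration.integral_diff[symmetric]) (intro integrable_circle_continuous c2 c4)+
  finally show ?thesis by (simp add: algebra_simps)
qed

text \<open>The points w = r \<zeta> and v = \<zeta> / r are mirror images in the circle, whence |z
  - v| = |z - w| / r for unimodular z. The difference of the kernels contains the factor |w - v| =
  (1 - r^2) / r, and everything collapses to (1 - r) (1 + r)^2 / |z - w|^3; the 4 bounds (1 +
  r)^2.\<close>

lemma reflected_kernel_bound:
  fixes r :: real and z \<zeta> :: complex
  assumes r: "0 < r" "r < 1" and z: "norm z = 1" and \<zeta>: "norm \<zeta> = 1"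
  shows "norm (1 / (z - r * \<zeta>) ^ 2 - 1 / (z - \<zeta> / r) ^ 2) \<le> 4 * (1 - r) / norm (z - r * \<zeta>) ^ 3"
proof -
  define w v where "w = r * \<zeta>" and "v = \<zeta> / r"
  have wn: "norm w = r" "norm v = 1 / r" using r \<zeta> by (auto simp: w_def v_def norm_mult norm_divide)
  have ne: "z \<noteq> w" "z \<noteq> v" using wn z r by auto
  have zz: "z * cnj z = 1" "\<zeta> * cnj \<zeta> = 1" using z \<zeta> by (auto simp: cnj_eq_inverse_circle)
  have "norm (z - w) = norm (cnj (z - w))" by (rule complex_mod_cnj[symmetric])
  also have "\<dots> = norm (z * \<zeta> * cnj (z - w))" using z \<zeta> by (simp add: norm_mult)
  also have "z * \<zeta> * cnj (z - w) = (z * cnj z) * \<zeta> - r * z * (\<zeta> * cnj \<zeta>)" by (simp add: w_def algebra_simps)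
  also have "\<dots> = - (r * (z - v))" using r by (simp only: zz) (simp add: v_def field_simps)
  also have "norm \<dots> = r * norm (z - v)" using r by (simp add: norm_mult)
  finally have nv: "norm (z - v) = norm (z - w) / r" using r by (simp add: field_simps)
  have "1 / (z - w) ^ 2 - 1 / (z - v) ^ 2 = (w - v) * ((z - w) + (z - v)) / ((z - w) ^ 2 * (z - v) ^ 2)"
    using ne by (simp add: divide_simps) (simp add: algebra_simps power2_eq_square)
  also have "norm \<dots> = norm (w - v) * norm ((z - w) + (z - v)) / (norm (z - w) ^ 2 * norm (z - v) ^ 2)"
    by (simp add: norm_mult norm_divide norm_power)
  also have "\<dots> \<le> norm (w - v) * (norm (z - w) + norm (z - v)) / (norm (z - w) ^ 2 * norm (z - v) ^ 2)"
    by (intro divide_right_mono mult_left_mono norm_triangle_ineq) auto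
  also have "norm (w - v) = (1 - r ^ 2) / r"
  proof -
    have "w - v = - (of_real ((1 - r ^ 2) / r) * \<zeta>)" using r by (simp add: w_def v_def field_simps power2_eq_square)
    then have "norm (w - v) = \<bar>(1 - r ^ 2) / r\<bar>" using \<zeta>
      by (simp only: norm_minus_cancel norm_mult norm_of_real mult_1_right)
    then show ?thesis using r by (simp add: power_le_one)
  qed
  also have "(1 - r ^ 2) / r * (norm (z - w) + norm (z - v)) / (norm (z - w) ^ 2 * norm (z - v) ^ 2)
     = (1 - r) * (1 + r) ^ 2 / norm (z - w) ^ 3"
    unfolding nv using r ne by (simp add: field_simps power2_eq_square power3_eq_cube)
  also have "\<dots> \<le> (1 - r) * 2 ^ 2 / norm (z - w) ^ 3"
    using r by (intro divide_right_mono mult_left_mono power_mono) auto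
  finally show ?thesis by (simp add: w_def v_def mult.commute)
qed

text \<open>Subtracting the linear part at \<zeta> leaves \<Psi> with derivative
  \<open>F w - L\<close> and with values o(|z - \<zeta>|) on the circle. Integrated against the
  reflected kernel, the small part costs at most a multiple of (1 - r) / |z - w|^2, whose mean over
  the circle stays bounded. Hence a limit taken along the circle controls the limit along the
  radius.\<close>

lemma radial_derivative_tendsto:
  fixes \<Phi> :: "complex \<Rightarrow> complex"
  assumes \<Phi>c: "continuous_on (cball 0 1) \<Phi>"
    and \<Phi>d: "\<And>w. norm w < 1 \<Longrightarrow> (\<Phi> has_field_derivative F w) (at w)"
    and \<zeta>: "norm \<zeta> = 1"
    and lim: "((\<lambda>z. (\<Phi> z - \<Phi> \<zeta>) / (z - \<zeta>)) \<longlongrightarrow> L) (at \<zeta> within sphere 0 1)"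
  shows "((\<lambda>r. F (of_real r * \<zeta>)) \<longlongrightarrow> L) (at_left (1::real))"
proof -
  define \<Psi> where "\<Psi> z = \<Phi> z - \<Phi> \<zeta> - L * (z - \<zeta>)" for z
  have \<Psi>c: "continuous_on (cball 0 1) \<Psi>" unfolding \<Psi>_def by (intro continuous_intros \<Phi>c)
  have \<Psi>c': "continuous_on (sphere 0 1) \<Psi>" by (rule continuous_on_subset[OF \<Psi>c]) auto
  have \<Psi>d: "(\<Psi> has_field_derivative (F w - L)) (at w)" if "norm w < 1" for w
    unfolding \<Psi>_def using that by (auto intro!: derivative_eq_intros \<Phi>d)
  have \<Psi>h: "\<Psi> holomorphic_on ball 0 1"
    unfolding holomorphic_on_open[OF open_ball] by (metis \<Psi>d mem_ball_0)
  have "bounded (\<Psi> ` sphere 0 1)"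
    by (intro compact_imp_bounded compact_continuous_image \<Psi>c') auto
  then obtain b where b: "b > 0" "\<And>z. norm z = 1 \<Longrightarrow> norm (\<Psi> z) \<le> b"
    by (auto simp: bounded_pos)
  have main: "\<exists>C\<ge>0. \<forall>r. 0 < r \<and> r < 1 \<longrightarrow> norm (F (of_real r * \<zeta>) - L) \<le> 8 * e + C * (1 - r)"
    if e: "e > 0" for e :: real
  proof -
    from tendstoD[OF lim e] obtain d where d: "d > 0"
      "\<And>z. norm z = 1 \<Longrightarrow> z \<noteq> \<zeta> \<Longrightarrow> dist z \<zeta> < d \<Longrightarrow> dist ((\<Phi> z - \<Phi> \<zeta>) / (z - \<zeta>)) L < e"
      by (auto simp: eventually_at)
    \<comment> \<open>At distance at least d from \<zeta> the bound b is absorbed into a cubic term.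
      The cube cancels the third power in the kernel bound, so that this part of the circle
      contributes only a constant times 1 - r.\<close>
    define c where "c = b / d ^ 3"
    have c0: "c \<ge> 0" using b d by (simp add: c_def)
    have \<Psi>b: "norm (\<Psi> z) \<le> e * norm (z - \<zeta>) + c * norm (z - \<zeta>) ^ 3" if z: "norm z = 1" for z
    proof (cases "dist z \<zeta> < d")
      case True
      have "norm (\<Psi> z) \<le> e * norm (z - \<zeta>)"
      proof (cases "z = \<zeta>")
        case False
        have "\<Psi> z = ((\<Phi> z - \<Phi> \<zeta>) / (z - \<zeta>) - L) * (z - \<zeta>)"
          using False by (simp add: \<Psi>_def field_simps)
        then have "norm (\<Psi> z) = norm ((\<Phi> z - \<Phi> \<zeta>) / (z - \<zeta>) - L) * norm (z - \<zeta>)"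
          by (simp add: norm_mult)
        also have "\<dots> \<le> e * norm (z - \<zeta>)"
          using d(2)[OF z False True] by (intro mult_right_mono) (auto simp: dist_norm)
        finally show ?thesis .
      qed (simp add: \<Psi>_def)
      then show ?thesis using c0 by (smt (verit) norm_ge_zero zero_le_mult_iff zero_le_power)
    next
      case False
      have "norm (\<Psi> z) \<le> b" by (rule b(2)[OF z])
      also have "b = c * d ^ 3" using d by (simp add: c_def)
      also have "\<dots> \<le> c * norm (z - \<zeta>) ^ 3"
        using False d c0 by (intro mult_left_mono power_mono) (auto simp: dist_norm)
      finally show ?thesis using e by (smt (verit) norm_ge_zero zero_le_mult_iff)
    qed
    \<comment> \<open>With x = |z - w|, the estimate |z - \<zeta>| \<le> 2 x and the kernel bound 4
      (1 - r) / x^3 turn the linear term into 8 e (1 - r) / x^2 and the cubic term into 32 c (1 -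
      r). The Poisson integral reduces the former to 8 e / (1 + r).\<close>
    have "norm (F (of_real r * \<zeta>) - L) \<le> 8 * e + (32 * c) * (1 - r)" if r: "0 < r" "r < 1" for r :: real
    proof -
      define w where "w = of_real r * \<zeta>"
      have w: "norm w = r" using r \<zeta> by (simp add: w_def norm_mult)
      have nzw: "z \<noteq> w" if "norm z = 1" for z using that w r by auto
      let ?K = "\<lambda>z. 1 / (z - w) ^ 2 - 1 / (z - \<zeta> / of_real r) ^ 2"
      have v: "norm (\<zeta> / of_real r) > 1" using r \<zeta> by (simp add: norm_divide)
      have Kc: "continuous_on (sphere 0 1) (\<lambda>z. \<Psi> z * z * ?K z)"
        by (intro continuous_intros \<Psi>c') (use nzw v in auto)
      have Pc: "continuous_on (sphere 0 1) (\<lambda>z. 8 * e * (1 - r) * (1 / norm (z - w) ^ 2) + 32 * c * (1 - r))"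
        by (intro continuous_intros) (use nzw in auto)
      have Pc2: "continuous_on (sphere 0 1) (\<lambda>z. 1 / norm (z - w) ^ 2)"
        by (intro continuous_intros) (use nzw in auto)
      have "F w - L = deriv \<Psi> w" using \<Psi>d[of w] w r by (simp add: DERIV_imp_deriv)
      also have "\<dots> = (LINT z|circle_measure. \<Psi> z * z * ?K z)"
        by (rule deriv_eq_reflected_kernel_integral[OF \<Psi>c \<Psi>h]) (use w r v in auto)
      finally have "norm (F w - L) \<le> (LINT z|circle_measure. norm (\<Psi> z * z * ?K z))"
        by simp
      also have "\<dots> \<le> (LINT z|circle_measure. 8 * e * (1 - r) * (1 / norm (z - w) ^ 2) + 32 * c * (1 - r))"
      proof (rule integral_mono)
        show "integrable circle_measure (\<lambda>z. norm (\<Psi> z * z * ?K z))"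
          by (intro integrable_norm integrable_circle_continuous Kc)
        show "integrable circle_measure (\<lambda>z. 8 * e * (1 - r) * (1 / norm (z - w) ^ 2) + 32 * c * (1 - r))"
          by (rule integrable_circle_continuous[OF Pc])
        fix z assume "z \<in> space circle_measure"
        then have z: "norm z = 1" by (simp add: space_circle_measure)
        define x where "x = norm (z - w)"
        have x: "x > 0" using nzw[OF z] by (simp add: x_def)
        \<comment> \<open>The distance from w to \<zeta> is 1 - r, the smallest possible distance
          from w to the circle.\<close>
        have "norm (z - \<zeta>) \<le> 2 * x"
        proof -
          have "norm (z - \<zeta>) \<le> norm (z - w) + norm (w - \<zeta>)" by norm
          also have "w - \<zeta> = - (of_real (1 - r) * \<zeta>)" by (simp add: w_def algebra_simps)
          also have "norm (- (of_real (1 - r) * \<zeta>)) = norm z - norm w" 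
            unfolding norm_minus_cancel norm_mult norm_of_real using r \<zeta> w z by simp
          also have "norm z - norm w \<le> norm (z - w)" by (rule norm_triangle_ineq2)
          finally show ?thesis by (simp add: x_def)
        qed
        have "norm (\<Psi> z * z * ?K z) = norm (\<Psi> z) * norm (?K z)" using z by (simp add: norm_mult)
        also have "\<dots> \<le> (e * norm (z - \<zeta>) + c * norm (z - \<zeta>) ^ 3) * (4 * (1 - r) / x ^ 3)"
          using \<Psi>b[OF z] reflected_kernel_bound[OF r z \<zeta>] e c0
          by (intro mult_mono) (auto simp: x_def w_def)
        also have "\<dots> \<le> (e * (2 * x) + c * (2 * x) ^ 3) * (4 * (1 - r) / x ^ 3)"
          using \<open>norm (z - \<zeta>) \<le> 2 * x\<close> e c0 r x
          by (intro mult_right_mono add_mono mult_left_mono power_mono) auto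
        also have "\<dots> = 8 * e * (1 - r) * (1 / x ^ 2) + 32 * c * (1 - r)"
          using x by (simp add: field_simps power2_eq_square power3_eq_cube)
        finally show "norm (\<Psi> z * z * ?K z) \<le> 8 * e * (1 - r) * (1 / norm (z - w) ^ 2) + 32 * c * (1 - r)"
          by (simp add: x_def)
      qed
      also have "\<dots> = 8 * e * (1 - r) * (LINT z|circle_measure. 1 / norm (z - w) ^ 2) + 32 * c * (1 - r)"
      proof -
        have "(LINT z|circle_measure. a * h z + k) = a * (LINT z|circle_measure. h z) + k"
          if "integrable circle_measure h" for a k :: real and h
          using that by (simp add: circ.prob_space)
        then show ?thesis using integrable_circle_continuous[OF Pc2] by blast
      qed
      also have "(LINT z|circle_measure. 1 / norm (z - w) ^ 2) = 1 / (1 - norm w ^ 2)"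
        by (rule Poisson_kernel_integral) (use w r in simp)
      also have "8 * e * (1 - r) * (1 / (1 - norm w ^ 2)) = 8 * e * (1 / (1 + r))"
      proof -
        have "1 - r ^ 2 = (1 - r) * (1 + r)" by (simp add: algebra_simps power2_eq_square)
        then show ?thesis unfolding w using r by simp
      qed
      also have "\<dots> \<le> 8 * e * 1" using e r by (intro mult_left_mono) auto
      finally show ?thesis by (simp add: w_def)
    qed
    then show ?thesis using c0 by (intro exI[of _ "32 * c"]) auto
  qed
  show ?thesis
  proof (rule tendstoI)
    fix e :: real assume e: "e > 0"
    obtain C where C: "C \<ge> 0" "\<And>r. 0 < r \<Longrightarrow> r < 1 \<Longrightarrow> norm (F (of_real r * \<zeta>) - L) \<le> 8 * (e / 16) + C * (1 - r)"
      using main[of "e / 16"] e by auto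
    have "((\<lambda>r. 8 * (e / 16) + C * (1 - r)) \<longlongrightarrow> 8 * (e / 16) + C * (1 - 1)) (at_left (1::real))"
      by (intro tendsto_intros)
    then have "\<forall>\<^sub>F r in at_left (1::real). 8 * (e / 16) + C * (1 - r) < e"
      by (rule order_tendstoD) (use e in simp)
    moreover have "\<forall>\<^sub>F r in at_left (1::real). 0 < r \<and> r < 1"
      using eventually_at_left_real[of 0 1] by auto
    ultimately show "\<forall>\<^sub>F r in at_left (1::real). dist (F (of_real r * \<zeta>)) L < e"
      by eventually_elim (use C(2) in \<open>force simp: dist_norm\<close>)
  qed
qed

lemma circle_difference_quotient_tendsto:
  fixes \<Phi> :: "complex \<Rightarrow> complex"
  assumes D: "((\<lambda>s. \<Phi> (cis s)) has_vector_derivative D) (at t)"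
  shows "((\<lambda>z. (\<Phi> z - \<Phi> (cis t)) / (z - cis t)) \<longlongrightarrow> D / (\<i> * cis t)) (at (cis t) within sphere 0 1)"
proof -
  \<comment> \<open>A branch of the angle centred at t: for z near \<open>cis t\<close> the quotient
    is near 1, away from the cut of \<open>Arg\<close>, so that s is continuous there.\<close>
  define s where "s z = t + Arg (z / cis t)" for z
  have cs: "cis (s z) = z" if "norm z = 1" for z
  proof -
    have "z / cis t \<noteq> 0" using that by auto
    then have "cis (Arg (z / cis t)) = sgn (z / cis t)" by (rule cis_Arg)
    also have "\<dots> = z / cis t" using that by (simp add: sgn_div_norm norm_divide)
    finally show ?thesis by (simp add: s_def cis_mult[symmetric])
  qed
  have s_lim: "filterlim s (at t) (at (cis t) within sphere 0 1)"
  proof (subst filterlim_at, intro conjI)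
    have "((\<lambda>z. t + Arg (z / cis t)) \<longlongrightarrow> t + Arg (cis t / cis t)) (at (cis t) within sphere 0 1)"
      by (intro tendsto_intros) (auto simp: complex_nonpos_Reals_iff intro!: tendsto_intros)
    then show "(s \<longlongrightarrow> t) (at (cis t) within sphere 0 1)" by (simp add: s_def[abs_def])
    show "\<forall>\<^sub>F z in at (cis t) within sphere 0 1. s z \<in> UNIV \<and> s z \<noteq> t"
      using cs by (auto simp: eventually_at intro!: exI[of _ 1])
  qed
  note q = has_vector_derivative_difference_quotient
  have dc: "(cis has_vector_derivative (\<i> * cis t)) (at t)"
    by (auto intro!: derivative_eq_intros simp: has_vector_derivative_def scaleR_conv_of_real mult_ac)
  have "((\<lambda>s. ((\<Phi> (cis s) - \<Phi> (cis t)) /\<^sub>R (s - t)) / ((cis s - cis t) /\<^sub>R (s - t))) \<longlongrightarrow> D / (\<i> * cis t)) (at t)"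
    by (intro tendsto_divide q[OF D] q[OF dc]) auto
  from filterlim_compose[OF this s_lim]
  have "((\<lambda>z. ((\<Phi> (cis (s z)) - \<Phi> (cis t)) /\<^sub>R (s z - t)) / ((cis (s z) - cis t) /\<^sub>R (s z - t))) \<longlongrightarrow> D / (\<i> * cis t))
      (at (cis t) within sphere 0 1)" .
  then show ?thesis
  proof (rule Lim_transform_eventually)
    show "\<forall>\<^sub>F z in at (cis t) within sphere 0 1.
       ((\<Phi> (cis (s z)) - \<Phi> (cis t)) /\<^sub>R (s z - t)) / ((cis (s z) - cis t) /\<^sub>R (s z - t)) = (\<Phi> z - \<Phi> (cis t)) / (z - cis t)"
    proof (rule eventually_at_filter[THEN iffD2], rule always_eventually, intro allI impI)
      fix z assume "z \<noteq> cis t" "z \<in> sphere 0 1"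
      then have z: "norm z = 1" "s z - t \<noteq> 0" using cs[of z] by auto
      then show "((\<Phi> (cis (s z)) - \<Phi> (cis t)) /\<^sub>R (s z - t)) / ((cis (s z) - cis t) /\<^sub>R (s z - t)) = (\<Phi> z - \<Phi> (cis t)) / (z - cis t)"
        by (simp add: cs scaleR_conv_of_real)
    qed
  qed
qed

text \<open>Fatou's theorem. A primitive of the bounded function F is Lipschitz on the disc, hence
  uniformly continuous, and so extends continuously to the closed disc; the kernel argument works
  with these boundary values.\<close>

theorem bounded_holomorphic_radial_limits:
  assumes F: "F holomorphic_on ball 0 1" and B: "\<And>w. norm w < 1 \<Longrightarrow> norm (F w) \<le> B"
  shows "AE z in circle_measure. \<exists>L. ((\<lambda>r. F (of_real r * z)) \<longlongrightarrow> L) (at_left (1::real))"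
proof -
  obtain \<Phi>0 where \<Phi>0: "\<And>w. w \<in> ball 0 1 \<Longrightarrow> (\<Phi>0 has_field_derivative F w) (at w within ball 0 1)"
    using holomorphic_convex_primitive'[OF convex_ball open_ball F] by blast
  have B0: "B \<ge> 0" using order_trans[OF norm_ge_zero B[of 0]] by simp
  have "norm (\<Phi>0 x - \<Phi>0 y) \<le> B * norm (x - y)" if "x \<in> ball 0 1" "y \<in> ball 0 1" for x y
    by (rule field_differentiable_bound[OF convex_ball \<Phi>0]) (use B that in auto)
  then have "B-lipschitz_on (ball 0 1) \<Phi>0"
    using B0 by (auto intro!: lipschitz_onI simp: dist_norm)
  then have "uniformly_continuous_on (ball 0 1) \<Phi>0"
    by (rule lipschitz_on_uniformly_continuous)
  then obtain \<Phi> where \<Phi>: "uniformly_continuous_on (closure (ball 0 1)) \<Phi>" "\<And>x. x \<in> ball 0 1 \<Longrightarrow> \<Phi>0 x = \<Phi> x"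
    using uniformly_continuous_on_extension_on_closure by metis
  have \<Phi>c: "continuous_on (cball 0 1) \<Phi>"
    using \<Phi>(1) by (auto dest: uniformly_continuous_imp_continuous)
  have \<Phi>d: "(\<Phi> has_field_derivative F w) (at w)" if "norm w < 1" for w
  proof -
    have "(\<Phi>0 has_field_derivative F w) (at w)"
      using \<Phi>0[of w] that at_within_open[of w "ball 0 1"] by auto
    then show ?thesis
      by (rule has_field_derivative_transform_within_open[where S="ball 0 1"]) (use \<Phi>(2) that in auto)
  qed
  show ?thesis
  proof (rule AE_circleI)
    have "\<exists>L. ((\<lambda>r. F (of_real r * cis t)) \<longlongrightarrow> L) (at_left (1::real))"
      if "((\<lambda>s. \<Phi> (cis s)) has_vector_derivative D) (at t)" for t D
      using radial_derivative_tendsto[OF \<Phi>c \<Phi>d _ circle_difference_quotient_tendsto[OF that]] by auto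
    with boundary_primitive_differentiable_AE[OF F B \<Phi>c \<Phi>d]
    show "AE t in lborel. 0 < t \<and> t < 2 * pi \<longrightarrow> (\<exists>L. ((\<lambda>r. F (of_real r * cis t)) \<longlongrightarrow> L) (at_left (1::real)))"
      by (auto elim!: eventually_mono)
  qed
qed

section \<open>Boundary maps of inner functions\<close>

text \<open>A relation rather than an operation on F: f matters only up to null sets, and products
  or powers of known boundary functions can be inserted for f directly.\<close>

definition has_radial_limits :: "(complex \<Rightarrow> complex) \<Rightarrow> (complex \<Rightarrow> complex) \<Rightarrow> bool" where
  "has_radial_limits F f \<longleftrightarrow>
     (AE z in circle_measure. ((\<lambda>r. F (of_real r * z)) \<longlongrightarrow> f z) (at_left (1::real)))"

text \<open>Rests on completeness: the null set on which f and h differ may carry arbitrary values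
  of h.\<close>

lemma measurable_circle_AE_cong:
  fixes f h :: "complex \<Rightarrow> 'b :: topological_space"
  assumes f: "f \<in> borel_measurable circle_measure" and eq: "AE z in circle_measure. f z = h z"
  shows "h \<in> borel_measurable circle_measure"
proof (rule measurableI)
  fix A :: "'b set" assume A: "A \<in> sets borel"
  show "h -` A \<inter> space circle_measure \<in> sets circle_measure"
  proof (rule circ.in_sets_AE)
    show "AE z in circle_measure. (z \<in> f -` A \<inter> space circle_measure) = (z \<in> h -` A \<inter> space circle_measure)"
      using eq by eventually_elim auto
    show "f -` A \<inter> space circle_measure \<in> sets circle_measure"
      using f A by (rule measurable_sets)
  qed auto
qed auto

text \<open>Measurability of limits and dominated convergence speak of sequences, so radial limits
  are sampled along this one.\<close>

definition radial_seq :: "nat \<Rightarrow> real" where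
  "radial_seq i = 1 - 1 / (real i + 1)"

lemma radial_seq: "0 \<le> radial_seq i" "radial_seq i < 1"
  by (auto simp: radial_seq_def field_simps)

lemma filterlim_radial_seq: "filterlim radial_seq (at_left 1) sequentially"
proof (rule tendsto_imp_filterlim_at_left)
  show "radial_seq \<longlonglongrightarrow> 1" unfolding radial_seq_def by real_asymp
qed (simp add: radial_seq)

lemma has_radial_limits_seq:
  "has_radial_limits F f \<Longrightarrow> AE z in circle_measure. (\<lambda>i. F (radial_seq i * z)) \<longlonglongrightarrow> f z"
  unfolding has_radial_limits_def
  by (auto elim!: eventually_mono intro: filterlim_compose[OF _ filterlim_radial_seq])

lemma continuous_on_radial_seq:
  assumes F: "F holomorphic_on ball 0 1"
  shows "continuous_on (sphere 0 1) (\<lambda>z::complex. F (radial_seq i * z))"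
  by (rule continuous_on_subset[OF continuous_on_dilate[OF F]]) (use radial_seq[of i] in auto)

lemma radial_limits_measurable:
  assumes F: "F holomorphic_on ball 0 1" and f: "has_radial_limits F f"
  shows "f \<in> borel_measurable circle_measure"
proof (rule measurable_circle_AE_cong)
  show "(\<lambda>z. lim (\<lambda>i. F (radial_seq i * z))) \<in> borel_measurable circle_measure"
    by (intro borel_measurable_lim_metric continuous_on_circle_measurable continuous_on_radial_seq F)
  show "AE z in circle_measure. lim (\<lambda>i. F (radial_seq i * z)) = f z"
    using has_radial_limits_seq[OF f] by eventually_elim (rule limI)
qed

lemma norm_radial_limit_le:
  assumes B: "\<And>w. norm w < 1 \<Longrightarrow> norm (F w) \<le> B" and f: "has_radial_limits F f"
  shows "AE z in circle_measure. norm (f z) \<le> B"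
  using has_radial_limits_seq[OF f] AE_norm_one
proof eventually_elim
  case (elim z)
  show ?case
    by (rule LIMSEQ_le_const2[OF tendsto_norm[OF elim(1)]])
       (use elim(2) in \<open>auto intro!: B norm_dilate_less simp: radial_seq\<close>)
qed

text \<open>The mean value property holds on each radius \<open>radial_seq i\<close>, where F is
  continuous; the bound B lets the radii tend to 1.\<close>

lemma integral_radial_limit:
  assumes F: "F holomorphic_on ball 0 1" and B: "\<And>w. norm w < 1 \<Longrightarrow> norm (F w) \<le> B"
    and f: "has_radial_limits F f"
  shows "(LINT z|circle_measure. f z) = F 0"
proof -
  have "(\<lambda>i. LINT z|circle_measure. F (radial_seq i * z)) \<longlonglongrightarrow> (LINT z|circle_measure. f z)"
  proof (rule integral_dominated_convergence[where w="\<lambda>_. B"])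
    show "AE z in circle_measure. norm (F (radial_seq i * z)) \<le> B" for i
      using AE_norm_one by eventually_elim (auto intro!: B norm_dilate_less simp: radial_seq)
    show "(\<lambda>z. F (radial_seq i * z)) \<in> borel_measurable circle_measure" for i
      by (intro continuous_on_circle_measurable continuous_on_radial_seq F)
  qed (use radial_limits_measurable[OF F f] has_radial_limits_seq[OF f] in auto)
  moreover have "(LINT z|circle_measure. F (radial_seq i * z)) = F 0" for i
  proof -
    have "norm (complex_of_real (radial_seq i)) < 1" using radial_seq[of i] by simp
    then show ?thesis
      using circle_mean_value[OF continuous_on_dilate[OF F] holomorphic_on_dilate[OF F]] by simp
  qed
  ultimately show ?thesis by (simp add: LIMSEQ_const_iff)
qed

lemma ex_radial_limits:
  assumes F: "F holomorphic_on ball 0 1" and B: "\<And>w. norm w < 1 \<Longrightarrow> norm (F w) \<le> B"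
  obtains f where "has_radial_limits F f"
proof
  show "has_radial_limits F (\<lambda>z. Lim (at_left (1::real)) (\<lambda>r. F (of_real r * z)))"
  proof -
    have "AE z in circle_measure. \<exists>L. ((\<lambda>r. F (of_real r * z)) \<longlongrightarrow> L) (at_left (1::real))"
      by (rule bounded_holomorphic_radial_limits[OF F B])
    then show ?thesis unfolding has_radial_limits_def
      by eventually_elim (auto simp: tendsto_Lim)
  qed
qed

section \<open>Inner functions and the moments of their boundary maps\<close>

lemma inner_function_holomorphic: "inner_function g \<Longrightarrow> g holomorphic_on ball 0 1"
  and inner_function_norm_less: "inner_function g \<Longrightarrow> norm w < 1 \<Longrightarrow> norm (g w) < 1"
  by (auto simp: inner_function_def Pi_iff)

lemma inner_function_norm_le: "inner_function g \<Longrightarrow> norm w < 1 \<Longrightarrow> norm (g w) \<le> 1"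
  using inner_function_norm_less less_imp_le by blast

lemma boundary_map_eqI:
  assumes "norm w = 1" "((\<lambda>r. g (of_real r * z)) \<longlongrightarrow> w) (at_left (1::real))"
  shows "boundary_map g z = w"
  using assms unfolding boundary_map_def by (auto simp: tendsto_Lim)

lemma norm_boundary_map [simp]: "norm (boundary_map g z) = 1"
proof (cases "\<exists>w. norm w = 1 \<and> ((\<lambda>r. g (of_real r * z)) \<longlongrightarrow> w) (at_left (1::real))")
  case True
  then show ?thesis using boundary_map_eqI by blast
next
  case False
  then show ?thesis by (simp only: boundary_map_def if_False norm_one)
qed

lemma has_radial_limits_boundary_map:
  assumes "inner_function g"
  shows "has_radial_limits g (boundary_map g)"
proof -
  have "AE z in circle_measure. \<exists>w. norm w = 1 \<and> ((\<lambda>r. g (of_real r * z)) \<longlongrightarrow> w) (at_left (1::real))"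
    using assms by (simp add: inner_function_def)
  then show ?thesis unfolding has_radial_limits_def
  proof eventually_elim
    case (elim z)
    then show ?case using boundary_map_eqI by metis
  qed
qed

lemma boundary_map_borel_measurable:
  "inner_function g \<Longrightarrow> boundary_map g \<in> borel_measurable circle_measure"
  by (rule radial_limits_measurable[OF inner_function_holomorphic has_radial_limits_boundary_map])

lemma inner_function_id: "inner_function id"
  unfolding inner_function_def
proof (intro conjI)
  show "AE z in circle_measure. \<exists>w. norm w = 1 \<and> ((\<lambda>r. id (of_real r * z)) \<longlongrightarrow> w) (at_left (1::real))"
    using AE_norm_one
  proof eventually_elim
    case (elim z)
    have "((\<lambda>r. id (of_real r * z)) \<longlongrightarrow> of_real 1 * z) (at_left (1::real))"
      unfolding id_def by (intro tendsto_intros)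
    with elim show ?case by auto
  qed
qed (auto intro: holomorphic_intros)

lemma boundary_map_id: "norm z = 1 \<Longrightarrow> boundary_map id z = z"
proof (rule boundary_map_eqI)
  have "((\<lambda>r. id (of_real r * z)) \<longlongrightarrow> of_real 1 * z) (at_left (1::real))"
    unfolding id_def by (intro tendsto_intros)
  then show "((\<lambda>r. id (of_real r * z)) \<longlongrightarrow> z) (at_left (1::real))" by simp
qed

lemma holomorphic_on_inner_compose:
  assumes "inner_function g" "h holomorphic_on ball 0 1"
  shows "(h \<circ> g) holomorphic_on ball 0 1"
  by (rule holomorphic_on_compose_gen[OF inner_function_holomorphic[OF assms(1)] assms(2)])
     (use inner_function_norm_less[OF assms(1)] in auto)

lemma has_radial_limits_power:
  "has_radial_limits F f \<Longrightarrow> has_radial_limits (\<lambda>z. F z ^ k) (\<lambda>z. f z ^ k)"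
  unfolding has_radial_limits_def by (auto elim!: eventually_mono intro: tendsto_power)

lemma integral_boundary_map_power:
  assumes g: "inner_function g" "g 0 = 0" and k: "k > 0"
  shows "(LINT z|circle_measure. boundary_map g z ^ k) = 0"
proof -
  have "(LINT z|circle_measure. boundary_map g z ^ k) = g 0 ^ k"
  proof (rule integral_radial_limit[where B=1 and F="\<lambda>z. g z ^ k"])
    show "(\<lambda>z. g z ^ k) holomorphic_on ball 0 1"
      by (intro holomorphic_intros inner_function_holomorphic g)
    show "has_radial_limits (\<lambda>z. g z ^ k) (\<lambda>z. boundary_map g z ^ k)"
      by (rule has_radial_limits_power[OF has_radial_limits_boundary_map[OF g(1)]])
    show "norm (g w ^ k) \<le> 1" if "norm w < 1" for w
      using inner_function_norm_le[OF g(1) that] by (simp add: norm_power power_le_one)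
  qed
  then show ?thesis using g k by simp
qed

lemma cnj_cancel_unit: "norm w = 1 \<Longrightarrow> w * cnj w = 1"
  by (metis complex_norm_square of_real_1 one_power2)

text \<open>Unimodularity cancels conjugate pairs, leaving a pure power or the conjugate of one,
  whose integral is a power of g 0. The values are those of normalised arc length, which is the
  source of measure preservation.\<close>

lemma integral_boundary_map_monomial:
  assumes g: "inner_function g" "g 0 = 0"
  shows "(LINT z|circle_measure. boundary_map g z ^ i * cnj (boundary_map g z) ^ j) = (if i = j then 1 else 0)"
proof -
  let ?T = "boundary_map g"
  have u: "?T z ^ k * cnj (?T z) ^ k = 1" for z k
    using cnj_cancel_unit[of "?T z"] by (simp add: power_mult_distrib[symmetric])
  consider "i = j" | k where "k > 0" "i = j + k" | k where "k > 0" "j = i + k"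
    using less_imp_add_positive[of i j] less_imp_add_positive[of j i]
    by (cases i j rule: linorder_cases) auto
  then show ?thesis
  proof cases
    case 1
    then show ?thesis by (simp add: u circ.prob_space)
  next
    case 2
    have "?T z ^ i * cnj (?T z) ^ j = ?T z ^ k" for z
      using u[of z j] by (simp add: 2 power_add mult_ac)
    then show ?thesis using integral_boundary_map_power[OF g \<open>k > 0\<close>] 2 by simp
  next
    case 3
    have "?T z ^ i * cnj (?T z) ^ j = cnj (?T z ^ k)" for z
      using u[of z i] by (simp add: 3 power_add mult_ac)
    then have "(LINT z|circle_measure. ?T z ^ i * cnj (?T z) ^ j) = cnj (LINT z|circle_measure. ?T z ^ k)"
      by (simp only: Bochner_Integration.integral_cnj)
    then show ?thesis using integral_boundary_map_power[OF g \<open>k > 0\<close>] 3 by simp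
  qed
qed

text \<open>The quotient is bounded near 0 by compactness. For |w| > 1/2, dividing |h w - h 0| \<le>
  2 B by |w| at most doubles the bound, hence \<open>4 * B\<close>.\<close>

lemma bounded_holomorphic_factor:
  assumes h: "h holomorphic_on ball 0 1" and B: "\<And>w. norm w < 1 \<Longrightarrow> norm (h w) \<le> B"
  obtains u C where "u holomorphic_on ball 0 1" "\<And>w. norm w < 1 \<Longrightarrow> norm (u w) \<le> C"
    "\<And>w. norm w < 1 \<Longrightarrow> h w = h 0 + w * u w" "deriv h 0 = u 0"
proof -
  have "(\<lambda>w. h w - h 0) holomorphic_on ball 0 1" by (intro holomorphic_intros h)
  then obtain u where u: "u holomorphic_on ball 0 1" "\<And>w. norm w < 1 \<Longrightarrow> h w - h 0 = w * u w"
    "deriv (\<lambda>w. h w - h 0) 0 = u 0"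
    by (rule Schwarz3) (simp, blast)
  have "continuous_on (cball 0 (1/2)) u"
    by (rule continuous_on_subset[OF holomorphic_on_imp_continuous_on[OF u(1)]]) auto
  then have "bounded (u ` cball 0 (1/2))" by (intro compact_imp_bounded compact_continuous_image) auto
  then obtain b where "\<forall>w\<in>cball 0 (1/2). norm (u w) \<le> b" by (auto simp: bounded_iff)
  then have b: "\<And>w. norm w \<le> 1/2 \<Longrightarrow> norm (u w) \<le> b" by auto
  have "norm (u w) \<le> max b (4 * B)" if w: "norm w < 1" for w
  proof (cases "norm w \<le> 1/2")
    case False
    have "1/2 * norm (u w) \<le> norm w * norm (u w)" using False by (intro mult_right_mono) auto
    also have "\<dots> = norm (h w - h 0)" using u(2)[OF w] by (simp add: norm_mult)
    also have "\<dots> \<le> B + B" using B[OF w] B[of 0] by (intro norm_triangle_le_diff add_mono) auto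
    finally show ?thesis by simp
  qed (use b in \<open>auto intro: max.coboundedI1\<close>)
  note uB = this
  show ?thesis
  proof (rule that[OF u(1) uB])
    have "h field_differentiable at 0"
      by (rule holomorphic_on_imp_differentiable_at[OF h]) auto
    then show "deriv h 0 = u 0" using u(3) by (simp add: deriv_diff)
    show "h w = h 0 + w * u w" if "norm w < 1" for w
      using u(2)[OF that] by (simp only: diff_eq_eq add.commute)
  qed
qed

text \<open>The point is that \<open>c\<close> depends on \<open>h\<close> and \<open>k\<close> only; \<open>g = id\<close> then identifies it. The induction writes
  \<open>h w = h 0 + w * u w\<close> and cancels one factor of \<open>boundary_map g\<close>.\<close>

lemma compose_moment_universal:
  assumes h: "h holomorphic_on ball 0 1" and B: "\<And>w. norm w < 1 \<Longrightarrow> norm (h w) \<le> B"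
  shows "\<exists>c. \<forall>g f. inner_function g \<longrightarrow> g 0 = 0 \<longrightarrow> has_radial_limits (h \<circ> g) f \<longrightarrow>
    (LINT z|circle_measure. f z * cnj (boundary_map g z) ^ k) = c"
  using h B
proof (induction k arbitrary: h B)
  case (0 h B)
  show ?case
  proof (intro exI[of _ "h 0"] allI impI)
    fix g f assume "inner_function g" "g 0 = 0" "has_radial_limits (h \<circ> g) f"
    then show "(LINT z|circle_measure. f z * cnj (boundary_map g z) ^ 0) = h 0"
      using integral_radial_limit[OF holomorphic_on_inner_compose[OF _ 0(1)], of g B f] 0(2)
      by (simp add: inner_function_norm_less)
  qed
next
  case (Suc k h B)
  obtain u C where u: "u holomorphic_on ball 0 1" "\<And>w. norm w < 1 \<Longrightarrow> norm (u w) \<le> C"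
    "\<And>w. norm w < 1 \<Longrightarrow> h w = h 0 + w * u w"
    using bounded_holomorphic_factor[OF Suc.prems] by metis
  obtain c where c: "\<And>g f. inner_function g \<Longrightarrow> g 0 = 0 \<Longrightarrow> has_radial_limits (u \<circ> g) f \<Longrightarrow>
    (LINT z|circle_measure. f z * cnj (boundary_map g z) ^ k) = c"
    using Suc.IH[OF u(1,2)] by blast
  show ?case
  proof (intro exI[of _ c] allI impI)
    fix g f assume g: "inner_function g" "g 0 = 0" and f: "has_radial_limits (h \<circ> g) f"
    let ?T = "boundary_map g"
    have [measurable]: "?T \<in> borel_measurable circle_measure" by (rule boundary_map_borel_measurable[OF g(1)])
    have ug: "(u \<circ> g) holomorphic_on ball 0 1" "\<And>w. norm w < 1 \<Longrightarrow> norm ((u \<circ> g) w) \<le> C"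
      using holomorphic_on_inner_compose[OF g(1) u(1)] u(2) inner_function_norm_less[OF g(1)] by auto
    \<comment> \<open>The function \<open>u \<circ> g\<close> is only known to be bounded, so
      Fatou's theorem has to supply its boundary values.\<close>
    obtain v where v: "has_radial_limits (u \<circ> g) v" using ex_radial_limits[OF ug] by blast
    have [measurable]: "v \<in> borel_measurable circle_measure" by (rule radial_limits_measurable[OF ug(1) v])
    have vC: "AE z in circle_measure. norm (v z) \<le> C" by (rule norm_radial_limit_le[OF ug(2) v])
    have fv: "AE z in circle_measure. f z = h 0 + ?T z * v z"
      using f v has_radial_limits_boundary_map[OF g(1)] AE_norm_one unfolding has_radial_limits_def
    proof eventually_elim
      case (elim z)
      have "((\<lambda>r. h 0 + g (of_real r * z) * (u \<circ> g) (of_real r * z)) \<longlongrightarrow> h 0 + ?T z * v z) (at_left (1::real))"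
        by (intro tendsto_intros elim)
      moreover have "\<forall>\<^sub>F r in at_left (1::real). h 0 + g (of_real r * z) * (u \<circ> g) (of_real r * z) = (h \<circ> g) (of_real r * z)"
      proof -
        have "\<forall>\<^sub>F r in at_left (1::real). 0 < r \<and> r < 1"
          using eventually_at_left_real[of 0 1] by auto
        then show ?thesis
        proof eventually_elim
          case (elim r)
          then have "norm (g (of_real r * z)) < 1"
            using \<open>norm z = 1\<close> by (intro inner_function_norm_less[OF g(1)]) (simp add: norm_mult)
          then show ?case by (simp add: u(3)[symmetric])
        qed
      qed
      ultimately have "((\<lambda>r. (h \<circ> g) (of_real r * z)) \<longlongrightarrow> h 0 + ?T z * v z) (at_left (1::real))"
        by (rule Lim_transform_eventually)
      then show ?case using elim(1) by (intro tendsto_unique[of "at_left (1::real)"]) auto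
    qed
    have i1: "integrable circle_measure (\<lambda>z. cnj (?T z) ^ Suc k)"
      by (rule integrable_circle[where B=1]) (auto simp: norm_mult norm_power)
    have i2: "integrable circle_measure (\<lambda>z. v z * cnj (?T z) ^ k)"
      by (rule integrable_circle[where B=C]) (use vC in \<open>auto simp: norm_mult norm_power\<close>)
    have fm: "f \<in> borel_measurable circle_measure"
      by (rule radial_limits_measurable[OF holomorphic_on_inner_compose[OF g(1) Suc.prems(1)] f])
    have "(LINT z|circle_measure. f z * cnj (?T z) ^ Suc k) =
       (LINT z|circle_measure. h 0 * cnj (?T z) ^ Suc k + v z * cnj (?T z) ^ k)"
    proof (rule integral_cong_AE)
      show "AE z in circle_measure. f z * cnj (?T z) ^ Suc k = h 0 * cnj (?T z) ^ Suc k + v z * cnj (?T z) ^ k"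
        using fv
      proof eventually_elim
        case (elim z)
        have "?T z * cnj (?T z) = 1" by (rule cnj_cancel_unit) simp
        moreover have "?T z * v z * cnj (?T z) ^ Suc k = (?T z * cnj (?T z)) * (v z * cnj (?T z) ^ k)"
          by (simp add: mult_ac)
        ultimately have "?T z * v z * cnj (?T z) ^ Suc k = v z * cnj (?T z) ^ k"
          by (simp only: mult_1_left)
        then show ?case by (simp only: elim distrib_right)
      qed
    qed (use fm in measurable)
    also have "\<dots> = h 0 * (LINT z|circle_measure. cnj (?T z) ^ Suc k) + (LINT z|circle_measure. v z * cnj (?T z) ^ k)"
      using i1 i2 by (subst Bochner_Integration.integral_add) (auto simp del: power_Suc)
    also have "(LINT z|circle_measure. cnj (?T z) ^ Suc k) = 0"
      using integral_boundary_map_monomial[OF g, of 0 "Suc k"] by simp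
    also have "(LINT z|circle_measure. v z * cnj (?T z) ^ k) = c" by (rule c[OF g v])
    finally show "(LINT z|circle_measure. f z * cnj (?T z) ^ Suc k) = c" by simp
  qed
qed

section \<open>Trigonometric polynomials and invariance of the circle measure\<close>

inductive circle_poly :: "(complex \<Rightarrow> complex) \<Rightarrow> bool" where
  monomial: "circle_poly (\<lambda>z. c * (z ^ i * cnj z ^ j))"
| add: "circle_poly p \<Longrightarrow> circle_poly q \<Longrightarrow> circle_poly (\<lambda>z. p z + q z)"

lemma circle_poly_mult_monomial:
  "circle_poly q \<Longrightarrow> circle_poly (\<lambda>z. (c * (z ^ i * cnj z ^ j)) * q z)"
proof (induction rule: circle_poly.induct)
  case (monomial c' i' j')
  have "(\<lambda>z. (c * (z ^ i * cnj z ^ j)) * (c' * (z ^ i' * cnj z ^ j'))) =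
      (\<lambda>z. (c * c') * (z ^ (i + i') * cnj z ^ (j + j')))"
    by (simp add: fun_eq_iff power_add mult_ac)
  then show ?case by (simp only: circle_poly.monomial)
next
  case (add p q)
  then show ?case by (simp only: distrib_left circle_poly.add)
qed

lemma circle_poly_mult: "circle_poly p \<Longrightarrow> circle_poly q \<Longrightarrow> circle_poly (\<lambda>z. p z * q z)"
proof (induction rule: circle_poly.induct)
  case (monomial c i j)
  then show ?case by (rule circle_poly_mult_monomial)
next
  case (add p p')
  then show ?case by (simp only: distrib_right circle_poly.add)
qed

lemma circle_poly_continuous: "circle_poly p \<Longrightarrow> continuous_on A p"
  by (induction rule: circle_poly.induct) (auto intro!: continuous_intros)

text \<open>The real Stone-Weierstrass theorem is applied to the algebra of real functions whose
  complex version is a \<open>circle_poly\<close>; it contains \<open>Re\<close> and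
  \<open>Im\<close>, which separate points.\<close>

lemma circle_poly_approx:
  fixes f :: "complex \<Rightarrow> real"
  assumes f: "continuous_on (sphere 0 1) f" and e: "e > 0"
  obtains p :: "complex \<Rightarrow> real" where "circle_poly (\<lambda>z. of_real (p z))"
    "\<And>z. norm z = 1 \<Longrightarrow> \<bar>f z - p z\<bar> < e"
proof -
  let ?P = "\<lambda>p :: complex \<Rightarrow> real. circle_poly (\<lambda>z. of_real (p z))"
  have "\<exists>p. ?P p \<and> (\<forall>z\<in>sphere 0 1. \<bar>f z - p z\<bar> < e)"
  proof (rule Stone_Weierstrass_HOL[OF _ _ _ _ _ _ f e])
    show "?P (\<lambda>x. c)" for c using monomial[of "of_real c" 0 0] by simp
    show "continuous_on (sphere 0 1) p" if "?P p" for p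
      using continuous_on_Re[OF circle_poly_continuous[OF that]] by simp
    show "?P (\<lambda>x. p x + q x)" if "?P p \<and> ?P q" for p q
      using add that by simp
    show "?P (\<lambda>x. p x * q x)" if "?P p \<and> ?P q" for p q
      using circle_poly_mult that by simp
    fix x y :: complex assume xy: "x \<in> sphere 0 1 \<and> y \<in> sphere 0 1 \<and> x \<noteq> y"
    have "(\<lambda>z. of_real (Re z)) = (\<lambda>z. (1/2) * (z ^ 1 * cnj z ^ 0) + (1/2) * (z ^ 0 * cnj z ^ 1))"
      by (simp add: fun_eq_iff complex_eq_iff)
    then have 1: "?P Re" by (simp only: monomial add)
    have "(\<lambda>z. of_real (Im z)) = (\<lambda>z. (-\<i>/2) * (z ^ 1 * cnj z ^ 0) + (\<i>/2) * (z ^ 0 * cnj z ^ 1))"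
      by (simp add: fun_eq_iff complex_eq_iff)
    then have 2: "?P Im" by (simp only: monomial add)
    from 1 2 xy show "\<exists>p. ?P p \<and> p x \<noteq> p y" by (auto simp: complex_eq_iff)
  qed auto
  then show ?thesis using that by auto
qed

text \<open>The right-hand side is the case \<open>g = id\<close>, whose boundary map is the
  identity on the circle, and the moments do not depend on g.\<close>

lemma integral_circle_poly_boundary_map:
  assumes g: "inner_function g" "g 0 = 0" and p: "circle_poly p"
  shows "(LINT z|circle_measure. p (boundary_map g z)) = (LINT z|circle_measure. p z)"
proof -
  have bnd: "\<exists>C. \<forall>z. norm z = 1 \<longrightarrow> norm (p z) \<le> C" if "circle_poly p" for p
  proof -
    have "bounded (p ` sphere 0 1)"
      by (intro compact_imp_bounded compact_continuous_image circle_poly_continuous that) auto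
    then obtain C where "\<forall>z\<in>sphere 0 1. norm (p z) \<le> C" by (auto simp: bounded_iff)
    then show ?thesis by (intro exI[of _ C]) simp
  qed
  have int: "integrable circle_measure (\<lambda>z. p (boundary_map g z))"
    if p: "circle_poly p" and g: "inner_function g" for p g
  proof -
    obtain C where "\<And>z. norm z = 1 \<Longrightarrow> norm (p z) \<le> C" using bnd[OF p] by blast
    moreover have "p \<in> borel_measurable borel"
      by (intro borel_measurable_continuous_onI circle_poly_continuous p)
    then have "(\<lambda>z. p (boundary_map g z)) \<in> borel_measurable circle_measure"
      using measurable_compose[OF boundary_map_borel_measurable[OF g]] by blast
    ultimately show ?thesis by (intro integrable_circle[where B=C]) auto
  qed
  have "(LINT z|circle_measure. p (boundary_map g z)) = (LINT z|circle_measure. p (boundary_map id z))"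
    using p
  proof induction
    case (monomial c i j)
    show ?case
      using integral_boundary_map_monomial[OF g, of i j]
        integral_boundary_map_monomial[OF inner_function_id id_apply, of i j]
      by (simp only: integral_mult_right_zero)
  next
    case (add p q)
    show ?case
      by (simp only: Bochner_Integration.integral_add int add.hyps g(1) inner_function_id add.IH)
  qed
  also have "\<dots> = (LINT z|circle_measure. p z)"
    by (intro Bochner_Integration.integral_cong) (auto simp: boundary_map_id space_circle_measure)
  finally show ?thesis .
qed

lemma integral_continuous_boundary_map:
  fixes f :: "complex \<Rightarrow> real"
  assumes g: "inner_function g" "g 0 = 0" and f: "continuous_on UNIV f"
  shows "(LINT z|circle_measure. f (boundary_map g z)) = (LINT z|circle_measure. f z)"
proof -
  let ?T = "boundary_map g"
  have fc: "continuous_on (sphere 0 1) f" using f continuous_on_subset by blast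
  have m: "(\<lambda>z. h (?T z)) \<in> borel_measurable circle_measure" if "continuous_on UNIV h" for h :: "complex \<Rightarrow> real"
    using measurable_compose[OF boundary_map_borel_measurable[OF g(1)]] borel_measurable_continuous_onI[OF that] by blast
  have int: "integrable circle_measure (\<lambda>z. h (?T z))" if h: "continuous_on UNIV h" for h :: "complex \<Rightarrow> real"
  proof -
    have "bounded (h ` sphere 0 1)"
      by (intro compact_imp_bounded compact_continuous_image continuous_on_subset[OF h]) auto
    then obtain C where "\<forall>z\<in>sphere 0 1. norm (h z) \<le> C" by (auto simp: bounded_iff)
    then have "\<And>z. norm z = 1 \<Longrightarrow> norm (h z) \<le> C" by auto
    then show ?thesis by (intro integrable_circle[where B=C] m h) auto
  qed
  have "\<bar>(LINT z|circle_measure. f (?T z)) - (LINT z|circle_measure. f z)\<bar> \<le> e" if e: "e > 0" for e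
  proof -
    obtain p where p: "circle_poly (\<lambda>z. of_real (p z))" "\<And>z. norm z = 1 \<Longrightarrow> \<bar>f z - p z\<bar> < e / 2"
      using circle_poly_approx[OF fc, of "e / 2"] e by auto
    have pc: "continuous_on A p" for A
      using continuous_on_Re[OF circle_poly_continuous[OF p(1)]] by simp
    have "(LINT z|circle_measure. p (?T z)) = (LINT z|circle_measure. p z)"
      using integral_circle_poly_boundary_map[OF g p(1)] by (simp only: integral_complex_of_real of_real_eq_iff)
    moreover have "\<bar>(LINT z|circle_measure. f (?T z)) - (LINT z|circle_measure. p (?T z))\<bar> \<le> e / 2"
    proof -
      have "\<bar>(LINT z|circle_measure. f (?T z) - p (?T z))\<bar> \<le> (LINT z|circle_measure. \<bar>f (?T z) - p (?T z)\<bar>)"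
        by (rule integral_abs_bound)
      also have "\<dots> \<le> (LINT z|circle_measure. e / 2)"
        using p(2) by (intro integral_mono integrable_abs Bochner_Integration.integrable_diff int f pc)
          (auto intro: less_imp_le)
      finally show ?thesis
        using int[OF f] int[OF pc] by (simp add: circ.prob_space)
    qed
    moreover have "\<bar>(LINT z|circle_measure. f z) - (LINT z|circle_measure. p z)\<bar> \<le> e / 2"
    proof -
      have "\<bar>(LINT z|circle_measure. f z - p z)\<bar> \<le> (LINT z|circle_measure. \<bar>f z - p z\<bar>)"
        by (rule integral_abs_bound)
      also have "\<dots> \<le> (LINT z|circle_measure. e / 2)"
        using p(2) by (intro integral_mono integrable_abs Bochner_Integration.integrable_diff
            integrable_circle_continuous fc pc)
          (auto intro: less_imp_le simp: space_circle_measure)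
      finally show ?thesis
        using integrable_circle_continuous[OF fc] integrable_circle_continuous[OF pc] by (simp add: circ.prob_space)
    qed
    ultimately show ?thesis by linarith
  qed
  then have "\<bar>(LINT z|circle_measure. f (?T z)) - (LINT z|circle_measure. f z)\<bar> \<le> 0"
    by (rule field_le_epsilon[of _ 0, simplified])
  then show ?thesis by simp
qed

lemma indicator_open_approx:
  fixes U :: "'a::metric_space set"
  assumes "open U"
  obtains f :: "nat \<Rightarrow> 'a \<Rightarrow> real" where "\<And>n. continuous_on UNIV (f n)" "\<And>n z. 0 \<le> f n z" "\<And>n z. f n z \<le> 1"
    "\<And>z. (\<lambda>n. f n z) \<longlonglongrightarrow> indicator U z"
proof (cases "U = UNIV")
  case True
  \<comment> \<open>The distance to the empty complement is 0 by convention, so the formula of the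
    other case would give 0 here.\<close>
  show ?thesis by (rule that[of "\<lambda>_ _. 1"]) (auto simp: True)
next
  case False
  define f where "f n z = min 1 (real n * infdist z (- U))" for n z
  have "(\<lambda>n. f n z) \<longlonglongrightarrow> indicator U z" for z
  proof (cases "z \<in> U")
    case True
    have "infdist z (- U) > 0"
      using True False \<open>open U\<close> in_closed_iff_infdist_zero[of "- U" z] infdist_nonneg[of z "- U"] by fastforce
    then obtain N :: nat where "1 < real N * infdist z (- U)" using ex_less_of_nat_mult by blast
    then have "f n z = 1" if "n \<ge> N" for n
      using that infdist_nonneg[of z "- U"] mult_right_mono[of "real N" "real n" "infdist z (- U)"]
      by (simp add: f_def)
    then have "\<forall>\<^sub>F n in sequentially. f n z = 1" by (auto simp: eventually_sequentially)
    then show ?thesis using True by (simp add: tendsto_eventually)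
  qed (simp add: f_def)
  then show ?thesis
    by (intro that[of f]) (auto simp: f_def infdist_nonneg intro!: continuous_intros)
qed

lemma boundary_map_measurable_circle:
  assumes "inner_function g"
  shows "boundary_map g \<in> circle_measure \<rightarrow>\<^sub>M restrict_space borel (sphere 0 1)"
  using boundary_map_borel_measurable[OF assms] by (intro measurable_restrict_space2) auto

text \<open>An intersection-stable generator, for the uniqueness of measures and for the induction
  over Borel sets.\<close>

lemma open_sets_generate_circle:
  "sets (restrict_space borel (sphere 0 1 :: complex set)) = sigma_sets (sphere 0 1) {U \<inter> sphere 0 1 |U. open U}"
proof -
  have b: "sets borel = sigma_sets UNIV {U :: complex set. open U}" by (simp add: borel_def)
  have "sphere 0 1 \<in> sigma_sets UNIV {U :: complex set. open U}"
    unfolding b[symmetric] by (simp add: borel_closed)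
  then have "sets (restrict_space borel (sphere 0 1 :: complex set)) =
      sigma_sets (sphere 0 1) (((\<inter>) (sphere 0 1)) ` {U. open U})"
    unfolding sets_restrict_space b by (rule sigma_sets_Int) auto
  also have "((\<inter>) (sphere 0 1)) ` {U :: complex set. open U} = {U \<inter> sphere 0 1 |U. open U}"
    by auto
  finally show ?thesis .
qed

text \<open>The target is the uncompleted measure: measurability into the completion requires
  preimages of null sets to be null, which is deduced from this identity.\<close>

lemma distr_boundary_map_borel_circle:
  assumes g: "inner_function g" "g 0 = 0"
  shows "distr circle_measure borel_circle (boundary_map g) = borel_circle"
proof -
  let ?T = "boundary_map g"
  let ?E = "{U \<inter> sphere 0 1 |U :: complex set. open U}"
  have Tm: "?T \<in> circle_measure \<rightarrow>\<^sub>M borel_circle"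
    using boundary_map_measurable_circle[OF g(1)] by simp
  have Ip: "id \<in> circle_measure \<rightarrow>\<^sub>M borel_circle"
    unfolding circle_measure_def by (intro measurable_completion) auto
  have main: "measure circle_measure (?T -` U \<inter> sphere 0 1) = measure circle_measure (U \<inter> sphere 0 1)"
    if U: "open U" for U
  proof -
    obtain f :: "nat \<Rightarrow> complex \<Rightarrow> real" where f: "\<And>n. continuous_on UNIV (f n)" "\<And>n z. 0 \<le> f n z" "\<And>n z. f n z \<le> 1"
      "\<And>z. (\<lambda>n. f n z) \<longlonglongrightarrow> indicator U z"
      using indicator_open_approx[OF U] by metis
    have fm: "f n \<in> borel_measurable borel" for n by (rule borel_measurable_continuous_onI[OF f(1)])
    have lim: "(\<lambda>n. LINT z|circle_measure. f n (S z)) \<longlonglongrightarrow> measure circle_measure (S -` U \<inter> sphere 0 1)"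
      if S: "S \<in> borel_measurable circle_measure" for S
    proof -
      have "(\<lambda>n. LINT z|circle_measure. f n (S z)) \<longlonglongrightarrow> (LINT z|circle_measure. indicator U (S z))"
        by (rule integral_dominated_convergence[where w="\<lambda>_. 1"])
           (use f measurable_compose[OF S fm] measurable_compose[OF S borel_measurable_indicator, of U] U in auto)
      also have "(LINT z|circle_measure. indicator U (S z)) = (LINT z|circle_measure. indicator (S -` U \<inter> sphere 0 1) z)"
        by (intro Bochner_Integration.integral_cong) (auto simp: indicator_def space_circle_measure)
      also have "\<dots> = measure circle_measure (S -` U \<inter> sphere 0 1)"
        using measurable_sets[OF S, of U] U by (simp add: space_circle_measure Int_absorb2 subset_iff)
      finally show ?thesis .
    qed
    have "(\<lambda>n. LINT z|circle_measure. f n (?T z)) \<longlonglongrightarrow> measure circle_measure (id -` U \<inter> sphere 0 1)"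
      using lim[of id] integral_continuous_boundary_map[OF g f(1)] continuous_on_circle_measurable[of id] by (simp add: continuous_on_id id_def)
    from LIMSEQ_unique[OF this lim[OF boundary_map_borel_measurable[OF g(1)]]] show ?thesis by simp
  qed
  show ?thesis
  proof (rule measure_eqI_generator_eq[where E="?E" and \<Omega>="sphere 0 1" and A="\<lambda>_. sphere 0 1"])
    show "Int_stable ?E"
    proof (rule Int_stableI, safe)
      fix U V :: "complex set" assume "open U" "open V"
      then show "\<exists>W. U \<inter> sphere 0 1 \<inter> (V \<inter> sphere 0 1) = W \<inter> sphere 0 1 \<and> open W"
        by (intro exI[of _ "U \<inter> V"]) auto
    qed
    show "?E \<subseteq> Pow (sphere 0 1)" by auto
    show "sets (distr circle_measure borel_circle ?T) = sigma_sets (sphere 0 1) ?E"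
      "sets borel_circle = sigma_sets (sphere 0 1) ?E"
      by (simp_all add: open_sets_generate_circle)
    show "range (\<lambda>_. sphere 0 1) \<subseteq> ?E" by auto
    show "emeasure (distr circle_measure borel_circle ?T) (sphere 0 1) \<noteq> \<infinity>"
      using finite_measure.emeasure_finite[OF prob_space.finite_measure[OF circ.prob_space_distr[OF Tm]]] by simp
    fix X assume "X \<in> ?E"
    then obtain U where U: "open U" "X = U \<inter> sphere 0 1" by auto
    have X: "X \<in> sets borel_circle" using U by (auto simp: sets_restrict_space)
    have "emeasure (distr circle_measure borel_circle ?T) X = emeasure circle_measure (?T -` X \<inter> space circle_measure)"
      using X by (rule emeasure_distr[OF Tm])
    also have "?T -` X \<inter> space circle_measure = ?T -` U \<inter> sphere 0 1" by (auto simp: U space_circle_measure)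
    also have "emeasure circle_measure \<dots> = emeasure circle_measure X"
      using main[OF U(1)] by (simp add: circ.emeasure_eq_measure U)
    also have "\<dots> = emeasure borel_circle X"
      unfolding circle_measure_def emeasure_completion[OF sets_completionI_sets[OF X]] main_part[OF X] ..
    finally show "emeasure (distr circle_measure borel_circle ?T) X = emeasure borel_circle X" .
  qed auto
qed

text \<open>With the image measure known, null sets pull back to null sets, which lifts both
  measurability and invariance to the completion.\<close>

lemma measure_preserving_boundary_map:
  assumes g: "inner_function g" "g 0 = 0"
  shows "measure_preserving circle_measure (boundary_map g)"
proof -
  let ?T = "boundary_map g"
  have Tm: "?T \<in> circle_measure \<rightarrow>\<^sub>M borel_circle"
    using boundary_map_measurable_circle[OF g(1)] by simp
  note eq = distr_boundary_map_borel_circle[OF g]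
  have "?T \<in> circle_measure \<rightarrow>\<^sub>M completion borel_circle"
    by (rule circ.measurable_completion2[OF Tm]) (simp only: eq)
  moreover have "distr circle_measure (completion borel_circle) ?T = completion borel_circle"
    using circ.completion_distr_eq[OF Tm] by (simp only: eq)
  ultimately show ?thesis
    unfolding measure_preserving_def circle_measure_def[symmetric] by simp
qed

lemma boundary_map_measurable:
  "inner_function g \<Longrightarrow> g 0 = 0 \<Longrightarrow> boundary_map g \<in> circle_measure \<rightarrow>\<^sub>M circle_measure"
  using measure_preserving_boundary_map by (auto simp: measure_preserving_def)

text \<open>Lets facts about \<open>boundary_map h\<close> that hold off a null set be evaluated at
  \<open>boundary_map g z\<close>.\<close>

lemma AE_boundary_map:
  assumes g: "inner_function g" "g 0 = 0" and P: "AE z in circle_measure. P z"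
  shows "AE z in circle_measure. P (boundary_map g z)"
proof (rule AE_distrD[OF boundary_map_measurable[OF g]])
  have eq: "distr circle_measure circle_measure (boundary_map g) = circle_measure"
    using measure_preserving_boundary_map[OF g] by (simp add: measure_preserving_def)
  show "AE z in distr circle_measure circle_measure (boundary_map g). P z"
    unfolding eq by (rule P)
qed

lemma integral_boundary_map:
  fixes f :: "complex \<Rightarrow> 'b::{banach, second_countable_topology}"
  assumes g: "inner_function g" "g 0 = 0" and f: "f \<in> borel_measurable circle_measure"
  shows "(LINT z|circle_measure. f (boundary_map g z)) = (LINT z|circle_measure. f z)"
  using integral_distr[OF boundary_map_measurable[OF g] f] measure_preserving_boundary_map[OF g]
  by (simp add: measure_preserving_def)

text \<open>By the universality of the moments, \<open>U\<close> has inner product 1 with the unimodular function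
  \<open>boundary_map h \<circ> boundary_map g\<close>; since \<open>\<bar>U\<bar> \<le> 1\<close>, the two agree. This avoids Lindeloef's theorem on
  limits along curves.\<close>

lemma radial_limit_compose:
  assumes g: "inner_function g" "g 0 = 0" and h: "inner_function h"
    and U: "has_radial_limits (h \<circ> g) U"
  shows "AE z in circle_measure. U z = boundary_map h (boundary_map g z)"
proof -
  let ?T = "boundary_map g" and ?H = "boundary_map h"
  have hol: "h holomorphic_on ball 0 1" and hb: "\<And>w. norm w < 1 \<Longrightarrow> norm (h w) \<le> 1"
    using inner_function_holomorphic[OF h] inner_function_norm_le[OF h] by auto
  have ghol: "(h \<circ> g) holomorphic_on ball 0 1" and gb: "\<And>w. norm w < 1 \<Longrightarrow> norm ((h \<circ> g) w) \<le> 1"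
    using holomorphic_on_inner_compose[OF g(1) hol] hb inner_function_norm_less[OF g(1)] by auto
  have Um [measurable]: "U \<in> borel_measurable circle_measure" by (rule radial_limits_measurable[OF ghol U])
  have Ub: "AE z in circle_measure. norm (U z) \<le> 1" by (rule norm_radial_limit_le[OF gb U])
  have Tm [measurable]: "?T \<in> borel_measurable circle_measure" by (rule boundary_map_borel_measurable[OF g(1)])
  have Hm [measurable]: "?H \<in> borel_measurable circle_measure" by (rule boundary_map_borel_measurable[OF h])
  have HTm [measurable]: "(\<lambda>z. ?H (?T z)) \<in> borel_measurable circle_measure"
    by (rule measurable_compose[OF boundary_map_measurable[OF g] Hm])
  have hcm: "(\<lambda>z. h (radial_seq i * z)) \<in> borel_measurable circle_measure" for i
    by (intro continuous_on_circle_measurable continuous_on_radial_seq hol)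
  have hTm: "(\<lambda>z. h (radial_seq i * ?T z)) \<in> borel_measurable circle_measure" for i
    by (rule measurable_compose[OF boundary_map_measurable[OF g] hcm])
  have idm: "(\<lambda>z. z) \<in> borel_measurable circle_measure"
    by (intro continuous_on_circle_measurable continuous_intros)
  have moments: "(LINT z|circle_measure. U z * cnj (?T z) ^ k) = (LINT z|circle_measure. ?H z * cnj z ^ k)" for k
  proof -
    obtain c where c: "\<And>g f. inner_function g \<Longrightarrow> g 0 = 0 \<Longrightarrow> has_radial_limits (h \<circ> g) f \<Longrightarrow>
      (LINT z|circle_measure. f z * cnj (boundary_map g z) ^ k) = c"
      using compose_moment_universal[OF hol hb, of k] by blast
    have "(LINT z|circle_measure. ?H z * cnj (boundary_map id z) ^ k) = c"
      by (rule c[OF inner_function_id id_apply]) (simp only: comp_id has_radial_limits_boundary_map h)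
    moreover have "(LINT z|circle_measure. ?H z * cnj (boundary_map id z) ^ k) = (LINT z|circle_measure. ?H z * cnj z ^ k)"
      by (intro Bochner_Integration.integral_cong) (simp_all only: boundary_map_id space_circle_measure mem_sphere_0)
    ultimately show ?thesis using c[OF g U] by simp
  qed
  \<comment> \<open>Dilations of h have Taylor series converging absolutely on the circle, so equal
    moments give equal pairings with them. Letting the radius tend to 1 pairs U with
    \<open>?H (?T z)\<close> and \<open>?H\<close> with itself.\<close>
  have "(LINT z|circle_measure. U z * cnj (h (radial_seq i * ?T z))) =
      (LINT z|circle_measure. ?H z * cnj (h (radial_seq i * z)))" for i
  proof -
    have "(\<lambda>n. cnj (taylor_coeff h n) * radial_seq i ^ n * (LINT z|circle_measure. U z * cnj (?T z) ^ n)) sums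
       (LINT z|circle_measure. U z * cnj (h (radial_seq i * ?T z)))"
      by (rule sums_integral_taylor[OF hol hb radial_seq Um Ub Tm]) auto
    moreover have "(\<lambda>n. cnj (taylor_coeff h n) * radial_seq i ^ n * (LINT z|circle_measure. ?H z * cnj z ^ n)) sums
       (LINT z|circle_measure. ?H z * cnj (h (radial_seq i * z)))"
      by (rule sums_integral_taylor[OF hol hb radial_seq Hm _ idm, of 1]) auto
    ultimately show ?thesis unfolding moments by (rule sums_unique2)
  qed
  moreover have "(\<lambda>i. LINT z|circle_measure. U z * cnj (h (radial_seq i * ?T z))) \<longlonglongrightarrow>
      (LINT z|circle_measure. U z * cnj (?H (?T z)))"
  proof (rule integral_dominated_convergence[where w="\<lambda>_. 1"])
    show "AE z in circle_measure. (\<lambda>i. U z * cnj (h (radial_seq i * ?T z))) \<longlonglongrightarrow> U z * cnj (?H (?T z))"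
      using AE_boundary_map[OF g has_radial_limits_seq[OF has_radial_limits_boundary_map[OF h]]]
      by eventually_elim (intro tendsto_intros)
    show "AE z in circle_measure. norm (U z * cnj (h (radial_seq i * ?T z))) \<le> 1" for i
      using Ub
    proof eventually_elim
      case (elim z)
      have "norm (h (radial_seq i * ?T z)) \<le> 1"
        by (intro hb norm_dilate_less) (use radial_seq[of i] in auto)
      with elim show ?case by (simp add: norm_mult mult_le_one)
    qed
  qed (use hTm in measurable)
  moreover have "(\<lambda>i. LINT z|circle_measure. ?H z * cnj (h (radial_seq i * z))) \<longlonglongrightarrow>
      (LINT z|circle_measure. ?H z * cnj (?H z))"
  proof (rule integral_dominated_convergence[where w="\<lambda>_. 1"])
    show "AE z in circle_measure. (\<lambda>i. ?H z * cnj (h (radial_seq i * z))) \<longlonglongrightarrow> ?H z * cnj (?H z)"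
      using has_radial_limits_seq[OF has_radial_limits_boundary_map[OF h]]
      by eventually_elim (intro tendsto_intros)
    show "AE z in circle_measure. norm (?H z * cnj (h (radial_seq i * z))) \<le> 1" for i
      using AE_norm_one
    proof eventually_elim
      case (elim z)
      have "norm (h (radial_seq i * z)) \<le> 1"
        by (intro hb norm_dilate_less) (use elim radial_seq[of i] in auto)
      then show ?case by (simp add: norm_mult)
    qed
  qed (use hcm in measurable)
  moreover have "(LINT z|circle_measure. ?H z * cnj (?H z)) = 1"
    by (simp add: cnj_cancel_unit circ.prob_space)
  ultimately have one: "(LINT z|circle_measure. U z * cnj (?H (?T z))) = 1"
    by (simp add: LIMSEQ_unique)
  have int: "integrable circle_measure (\<lambda>z. U z * cnj (?H (?T z)))"
    by (rule integrable_circle[where B=1]) (use Ub in \<open>auto simp: norm_mult\<close>)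
  \<comment> \<open>D dominates the squared distance of U and \<open>?H (?T z)\<close> because the
    first has modulus at most 1 and the second is unimodular. Its integral is 2 - 2 = 0, so it
    vanishes almost everywhere.\<close>
  define D where "D z = 2 - 2 * Re (U z * cnj (?H (?T z)))" for z
  have Dint: "integrable circle_measure D"
    unfolding D_def using int by (intro Bochner_Integration.integrable_diff integrable_mult_right integrable_Re) auto
  have "(LINT z|circle_measure. Re (U z * cnj (?H (?T z)))) = 1"
    using integral_Re[OF int] one by simp
  then have D0: "(LINT z|circle_measure. D z) = 0"
  proof -
    have "(LINT z|circle_measure. 2 - 2 * R z) = 0"
      if "integrable circle_measure R" "(LINT z|circle_measure. R z) = 1" for R :: "complex \<Rightarrow> real"
      using that by (simp add: circ.prob_space)
    then show ?thesis
      unfolding D_def using integrable_Re[OF int] \<open>(LINT z|circle_measure. Re _) = 1\<close> by blast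
  qed
  have DU: "AE z in circle_measure. norm (U z - ?H (?T z)) ^ 2 \<le> D z"
    using Ub
  proof eventually_elim
    case (elim z)
    then have "norm (U z) ^ 2 \<le> 1" by (simp add: power_le_one)
    then show ?case unfolding cmod_diff_squared D_def norm_boundary_map by simp
  qed
  then have "AE z in circle_measure. 0 \<le> D z" by eventually_elim (meson order_trans zero_le_power2)
  then have "AE z in circle_measure. D z = 0"
    using integral_nonneg_eq_0_iff_AE[OF Dint] D0 by simp
  with DU show ?thesis by eventually_elim simp
qed

text \<open>Fatou's theorem provides the radial limit of the composition, and
  \<open>radial_limit_compose\<close> identifies it with a unimodular function; this is both the
  inner property and the composition law.\<close>

lemma
  assumes g: "inner_function g" "g 0 = 0" and h: "inner_function h"
  shows inner_function_compose: "inner_function (h \<circ> g)"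
    and boundary_map_compose: "AE z in circle_measure. boundary_map (h \<circ> g) z = boundary_map h (boundary_map g z)"
proof -
  have ghol: "(h \<circ> g) holomorphic_on ball 0 1" and gb: "\<And>w. norm w < 1 \<Longrightarrow> norm ((h \<circ> g) w) < 1"
    using holomorphic_on_inner_compose[OF g(1) inner_function_holomorphic[OF h]]
      inner_function_norm_less[OF h] inner_function_norm_less[OF g(1)] by auto
  obtain U where U: "has_radial_limits (h \<circ> g) U"
    using ex_radial_limits[OF ghol less_imp_le[OF gb]] by blast
  have lim: "AE z in circle_measure. ((\<lambda>r. (h \<circ> g) (of_real r * z)) \<longlongrightarrow> boundary_map h (boundary_map g z)) (at_left (1::real))"
    using radial_limit_compose[OF g h U] U unfolding has_radial_limits_def by eventually_elim simp
  show "inner_function (h \<circ> g)"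
    unfolding inner_function_def
  proof (intro conjI ghol)
    show "h \<circ> g \<in> ball 0 1 \<rightarrow> ball 0 1" using gb by auto
    show "AE z in circle_measure. \<exists>w. norm w = 1 \<and> ((\<lambda>r. (h \<circ> g) (of_real r * z)) \<longlongrightarrow> w) (at_left (1::real))"
      using lim by eventually_elim (use norm_boundary_map in blast)
  qed
  show "AE z in circle_measure. boundary_map (h \<circ> g) z = boundary_map h (boundary_map g z)"
    using lim by eventually_elim (rule boundary_map_eqI[OF norm_boundary_map])
qed

section \<open>Iterated compositions and the correlations of their boundary maps\<close>

lemma comp_seq_self [simp]: "comp_seq g m m = id"
  by (simp add: comp_seq_def)

lemma comp_seq_Suc: "m \<le> n \<Longrightarrow> comp_seq g m (Suc n) = g (Suc n) \<circ> comp_seq g m n"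
  by (simp add: comp_seq_def)

lemma comp_seq_compose:
  assumes "k \<le> m" "m \<le> n"
  shows "comp_seq g k n = comp_seq g m n \<circ> comp_seq g k m"
  using assms(2)
proof (induction n rule: dec_induct)
  case (step n)
  then show ?case using assms(1) by (simp add: comp_seq_Suc o_assoc)
qed simp

lemma comp_seq_inner:
  assumes g: "\<And>n. n \<ge> 1 \<Longrightarrow> inner_function (g n)" "\<And>n. n \<ge> 1 \<Longrightarrow> g n 0 = 0" and "m \<le> n"
  shows "inner_function (comp_seq g m n) \<and> comp_seq g m n 0 = 0"
  using \<open>m \<le> n\<close>
proof (induction n rule: dec_induct)
  case (step n)
  then have "inner_function (g (Suc n) \<circ> comp_seq g m n)"
    using g(1)[of "Suc n"] by (intro inner_function_compose) auto
  moreover have "(g (Suc n) \<circ> comp_seq g m n) 0 = 0" using step(3) g(2)[of "Suc n"] by simp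
  ultimately show ?case unfolding comp_seq_Suc[OF step(1)] by (rule conjI)
qed (unfold comp_seq_self, intro conjI inner_function_id id_apply)

text \<open>The composition law and invariance of the measure remove g. What remains is the mean of
  the boundary values of (h z / z)^l, a bounded holomorphic function with value h'(0)^l at
  0.\<close>

lemma integral_boundary_map_correlation:
  assumes g: "inner_function g" "g 0 = 0" and h: "inner_function h" "h 0 = 0"
  shows "(LINT z|circle_measure. boundary_map (h \<circ> g) z ^ l * cnj (boundary_map g z ^ l)) = deriv h 0 ^ l"
proof -
  let ?H = "boundary_map h"
  obtain u C where u: "u holomorphic_on ball 0 1" "\<And>w. norm w < 1 \<Longrightarrow> norm (u w) \<le> C"
    "\<And>w. norm w < 1 \<Longrightarrow> h w = h 0 + w * u w" "deriv h 0 = u 0"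
    using bounded_holomorphic_factor[OF inner_function_holomorphic[OF h(1)] inner_function_norm_le[OF h(1)]] by metis
  \<comment> \<open>Division by z in the disc becomes multiplication by \<open>cnj z\<close> on the
    circle: \<open>h (of_real r * z) * cnj z / of_real r\<close> is exactly
    \<open>u (of_real r * z)\<close>.\<close>
  have hu: "has_radial_limits u (\<lambda>z. ?H z * cnj z)"
    using has_radial_limits_boundary_map[OF h(1)] AE_norm_one unfolding has_radial_limits_def
  proof eventually_elim
    case (elim z)
    have "((\<lambda>r. h (of_real r * z) * cnj z / of_real r) \<longlongrightarrow> ?H z * cnj z / of_real 1) (at_left (1::real))"
      by (intro tendsto_intros elim) auto
    moreover have "\<forall>\<^sub>F r in at_left (1::real). h (of_real r * z) * cnj z / of_real r = u (of_real r * z)"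
    proof -
      have "\<forall>\<^sub>F r in at_left (1::real). 0 < r \<and> r < 1"
        using eventually_at_left_real[of 0 1] by auto
      then show ?thesis
      proof eventually_elim
        case (elim r)
        then have "h (of_real r * z) = of_real r * z * u (of_real r * z)"
          using u(3)[of "of_real r * z"] h(2) \<open>norm z = 1\<close> by (simp add: norm_mult)
        then have "h (of_real r * z) * cnj z = of_real r * u (of_real r * z) * (z * cnj z)"
          by (simp add: mult_ac)
        then show ?case using elim cnj_cancel_unit[OF \<open>norm z = 1\<close>] by simp
      qed
    qed
    ultimately show ?case by (auto dest: Lim_transform_eventually)
  qed
  have Gm: "(\<lambda>z. ?H z ^ l * cnj (z ^ l)) \<in> borel_measurable circle_measure"
    using boundary_map_borel_measurable[OF h(1)] continuous_on_circle_measurable[OF continuous_on_id] by measurable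
  have "(LINT z|circle_measure. boundary_map (h \<circ> g) z ^ l * cnj (boundary_map g z ^ l)) =
      (LINT z|circle_measure. ?H (boundary_map g z) ^ l * cnj (boundary_map g z ^ l))"
  proof (rule integral_cong_AE)
    show "AE z in circle_measure. boundary_map (h \<circ> g) z ^ l * cnj (boundary_map g z ^ l) =
        ?H (boundary_map g z) ^ l * cnj (boundary_map g z ^ l)"
      using boundary_map_compose[OF g h(1)] by eventually_elim simp
    show "(\<lambda>z. boundary_map (h \<circ> g) z ^ l * cnj (boundary_map g z ^ l)) \<in> borel_measurable circle_measure"
      using boundary_map_borel_measurable[OF inner_function_compose[OF g h(1)]]
        boundary_map_borel_measurable[OF g(1)] by measurable
    show "(\<lambda>z. ?H (boundary_map g z) ^ l * cnj (boundary_map g z ^ l)) \<in> borel_measurable circle_measure"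
      by (rule measurable_compose[OF boundary_map_measurable[OF g] Gm])
  qed
  also have "\<dots> = (LINT z|circle_measure. ?H z ^ l * cnj (z ^ l))"
    by (rule integral_boundary_map[OF g Gm])
  also have "\<dots> = (LINT z|circle_measure. (?H z * cnj z) ^ l)"
    by (simp add: power_mult_distrib)
  also have "\<dots> = u 0 ^ l"
  proof (rule integral_radial_limit[where B="C ^ l" and F="\<lambda>z. u z ^ l"])
    show "(\<lambda>z. u z ^ l) holomorphic_on ball 0 1" by (intro holomorphic_intros u)
    show "has_radial_limits (\<lambda>z. u z ^ l) (\<lambda>z. (?H z * cnj z) ^ l)" by (rule has_radial_limits_power[OF hu])
    show "norm (u w ^ l) \<le> C ^ l" if "norm w < 1" for w
      using u(2)[OF that] by (simp add: norm_power power_mono)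
  qed
  finally show ?thesis by (simp add: u(4))
qed

section \<open>Mean convergence along measure-preserving sequences\<close>

lemma norm_add_squared_le:
  "norm (x + y :: 'a::real_normed_vector) ^ 2 \<le> 2 * norm x ^ 2 + 2 * norm y ^ 2"
proof -
  have "norm (x + y) ^ 2 \<le> (norm x + norm y) ^ 2" by (intro power_mono norm_triangle_ineq) auto
  also have "\<dots> \<le> 2 * norm x ^ 2 + 2 * norm y ^ 2"
    using sum_squares_ge_zero[of "norm x - norm y" 0] by (simp add: power2_eq_square algebra_simps)
  finally show ?thesis .
qed

lemma norm_average_squared_le:
  fixes f :: "nat \<Rightarrow> complex"
  shows "norm (1 / of_nat N * (\<Sum>n=1..N. f n)) ^ 2 \<le> 1 / N * (\<Sum>n=1..N. norm (f n) ^ 2)"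
proof (cases "N = 0")
  case False
  have "norm (\<Sum>n=1..N. f n) ^ 2 \<le> (\<Sum>n=1..N. norm (f n)) ^ 2"
    by (intro power_mono norm_sum) auto
  also have "\<dots> \<le> (\<Sum>n=1..N. norm (f n) ^ 2) * N"
    using sum_squared_le_sum_of_squares[of "\<lambda>n. norm (f n)" "{1..N}"] by simp
  finally have "norm (\<Sum>n=1..N. f n) ^ 2 / N ^ 2 \<le> (\<Sum>n=1..N. norm (f n) ^ 2) * N / N ^ 2"
    by (intro divide_right_mono) auto
  then show ?thesis using False
    by (simp add: norm_divide power_divide power2_eq_square)
qed auto

locale measure_preserving_sequence = prob_space M for M :: "'a measure" +
  fixes T :: "nat \<Rightarrow> 'a \<Rightarrow> 'a"
  assumes preserving: "n \<ge> 1 \<Longrightarrow> measure_preserving M (T n)"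
begin

lemma T_measurable: "n \<ge> 1 \<Longrightarrow> T n \<in> M \<rightarrow>\<^sub>M M"
  using preserving by (simp add: measure_preserving_def)

lemma measurable_comp_T: "n \<ge> 1 \<Longrightarrow> f \<in> M \<rightarrow>\<^sub>M L \<Longrightarrow> (\<lambda>x. f (T n x)) \<in> M \<rightarrow>\<^sub>M L"
  using measurable_compose[OF T_measurable] .

lemma integral_T:
  fixes f :: "'a \<Rightarrow> 'b::{banach, second_countable_topology}"
  assumes "n \<ge> 1" "f \<in> borel_measurable M"
  shows "(LINT x|M. f (T n x)) = (LINT x|M. f x)"
  using integral_distr[OF T_measurable[OF assms(1)] assms(2)] preserving[OF assms(1)]
  by (simp add: measure_preserving_def)

lemma integrable_T:
  fixes f :: "'a \<Rightarrow> 'b::{banach, second_countable_topology}"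
  assumes "n \<ge> 1" "integrable M f"
  shows "integrable M (\<lambda>x. f (T n x))"
  using integrable_distr[OF T_measurable[OF assms(1)], of f] preserving[OF assms(1)] assms(2)
  by (simp add: measure_preserving_def)

lemma square_integrable_integrable:
  assumes "square_integrable M f"
  shows "integrable M f"
proof (rule Bochner_Integration.integrable_bound)
  show "integrable M (\<lambda>x. 1 + norm (f x) ^ 2)" using assms by (simp add: square_integrable_def)
  show "AE x in M. norm (f x) \<le> norm (1 + norm (f x) ^ 2)"
  proof (rule AE_I2)
    fix x
    have "0 \<le> (norm (f x) - 1) ^ 2" by simp
    then have "2 * norm (f x) \<le> 1 + norm (f x) ^ 2" by (simp add: power2_eq_square algebra_simps)
    then have "norm (f x) \<le> 1 + norm (f x) ^ 2" using norm_ge_zero[of "f x"] by linarith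
    then show "norm (f x) \<le> norm (1 + norm (f x) ^ 2)" by simp
  qed
qed (use assms in \<open>simp add: square_integrable_def\<close>)

lemma square_integrable_add:
  assumes "square_integrable M f" "square_integrable M h"
  shows "square_integrable M (\<lambda>x. f x + h x)"
  unfolding square_integrable_def
proof
  show m: "(\<lambda>x. f x + h x) \<in> borel_measurable M" using assms by (auto simp: square_integrable_def)
  show "integrable M (\<lambda>x. (norm (f x + h x))\<^sup>2)"
  proof (rule Bochner_Integration.integrable_bound)
    show "integrable M (\<lambda>x. 2 * norm (f x) ^ 2 + 2 * norm (h x) ^ 2)"
      using assms by (simp add: square_integrable_def)
    show "AE x in M. norm (norm (f x + h x) ^ 2) \<le> norm (2 * norm (f x) ^ 2 + 2 * norm (h x) ^ 2)"
      using norm_add_squared_le[of "f _" "h _"] by (intro AE_I2) simp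
  qed (use m in simp)
qed

lemma square_integrable_mult:
  "square_integrable M f \<Longrightarrow> square_integrable M (\<lambda>x. c * f x)"
  by (auto simp: square_integrable_def norm_mult power_mult_distrib)

lemma square_integrable_const: "square_integrable M (\<lambda>x. c)"
  by (simp add: square_integrable_def)

lemma square_integrable_diff:
  "square_integrable M f \<Longrightarrow> square_integrable M h \<Longrightarrow> square_integrable M (\<lambda>x. f x - h x)"
  using square_integrable_add[of f "\<lambda>x. (-1) * h x"] square_integrable_mult[of h "-1"] by simp

lemma square_integrable_T:
  "n \<ge> 1 \<Longrightarrow> square_integrable M f \<Longrightarrow> square_integrable M (\<lambda>x. f (T n x))"
  using integrable_T[of n "\<lambda>x. norm (f x) ^ 2"] by (simp add: square_integrable_def measurable_comp_T)

lemma square_integrable_sum: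
  "finite A \<Longrightarrow> (\<And>i. i \<in> A \<Longrightarrow> square_integrable M (f i)) \<Longrightarrow> square_integrable M (\<lambda>x. \<Sum>i\<in>A. f i x)"
  by (induction A rule: finite_induct) (auto intro: square_integrable_add square_integrable_const)

definition deviation :: "('a \<Rightarrow> complex) \<Rightarrow> nat \<Rightarrow> 'a \<Rightarrow> complex" where
  "deviation f N x = 1 / of_nat N * (\<Sum>n=1..N. f (T n x)) - (LINT y|M. f y)"

text \<open>Square integrability is included so that the closure properties need no side condition.
  The norm is squared because both the estimates and the expansion into correlations concern
  squares.\<close>

definition mean_converges :: "('a \<Rightarrow> complex) \<Rightarrow> bool" where
  "mean_converges f \<longleftrightarrow> square_integrable M f \<and>
     (\<lambda>N. LINT x|M. norm (deviation f N x) ^ 2) \<longlonglongrightarrow> 0"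

lemma mean_converges_iff_L2_norm:
  "mean_converges f \<longleftrightarrow> square_integrable M f \<and>
     (\<lambda>N. L2_norm M (\<lambda>x. 1 / of_nat N * (\<Sum>n=1..N. f (T n x)) - (LINT y|M. f y))) \<longlonglongrightarrow> 0"
proof -
  let ?e = "\<lambda>N. LINT x|M. norm (deviation f N x) ^ 2"
  have e0: "?e N \<ge> 0" for N by simp
  have "?e \<longlonglongrightarrow> 0 \<longleftrightarrow> (\<lambda>N. sqrt (?e N)) \<longlonglongrightarrow> 0"
  proof
    assume "?e \<longlonglongrightarrow> 0"
    from tendsto_real_sqrt[OF this] show "(\<lambda>N. sqrt (?e N)) \<longlonglongrightarrow> 0" by simp
  next
    assume "(\<lambda>N. sqrt (?e N)) \<longlonglongrightarrow> 0"
    from tendsto_power[OF this, of 2] show "?e \<longlonglongrightarrow> 0" by simp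
  qed
  then show ?thesis unfolding mean_converges_def L2_norm_def deviation_def by blast
qed

lemma square_integrable_deviation:
  assumes "square_integrable M f"
  shows "square_integrable M (deviation f N)"
proof -
  have "square_integrable M (\<lambda>x. \<Sum>n=1..N. f (T n x))"
    by (rule square_integrable_sum) (auto intro: square_integrable_T[OF _ assms])
  then show ?thesis
    unfolding deviation_def[abs_def]
    by (intro square_integrable_diff square_integrable_mult square_integrable_const)
qed

text \<open>A bound uniform in N, which makes mean convergence stable under L2 limits. Average and
  mean each have squared norm at most that of f, by measure preservation and by nonnegative
  variance; splitting their difference costs a factor 2 for each.\<close>

lemma integral_deviation_le:
  assumes f: "square_integrable M f" and N: "N \<ge> 1"
  shows "(LINT x|M. norm (deviation f N x) ^ 2) \<le> 4 * (LINT x|M. norm (f x) ^ 2)"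
proof -
  let ?I = "LINT x|M. norm (f x) ^ 2"
  have fi: "integrable M (\<lambda>x. norm (f x) ^ 2)" using f by (simp add: square_integrable_def)
  have "norm (LINT y|M. f y) \<le> (LINT y|M. norm (f y))" by simp
  then have "norm (LINT y|M. f y) ^ 2 \<le> (LINT y|M. norm (f y)) ^ 2" by (intro power_mono) auto
  also have "\<dots> \<le> ?I"
  proof -
    have "variance (\<lambda>x. norm (f x)) \<ge> 0" by (rule variance_positive)
    then show ?thesis
      by (subst (asm) variance_eq) (use fi square_integrable_integrable[OF f] in auto)
  qed
  finally have c: "norm (LINT y|M. f y) ^ 2 \<le> ?I" .
  have i: "integrable M (\<lambda>x. norm (f (T n x)) ^ 2)" if "n \<in> {1..N}" for n
    using integrable_T[of n, OF _ fi] that by simp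
  have "(LINT x|M. norm (deviation f N x) ^ 2) \<le>
      (LINT x|M. 2 * (1 / N * (\<Sum>n=1..N. norm (f (T n x)) ^ 2)) + 2 * norm (LINT y|M. f y) ^ 2)"
  proof (rule integral_mono)
    show "integrable M (\<lambda>x. norm (deviation f N x) ^ 2)"
      using square_integrable_deviation[OF f] by (simp add: square_integrable_def)
    show "integrable M (\<lambda>x. 2 * (1 / N * (\<Sum>n=1..N. norm (f (T n x)) ^ 2)) + 2 * norm (LINT y|M. f y) ^ 2)"
      using i by (intro Bochner_Integration.integrable_add integrable_mult_right Bochner_Integration.integrable_sum) auto
    fix x
    have "norm (deviation f N x) ^ 2 \<le> 2 * norm (1 / of_nat N * (\<Sum>n=1..N. f (T n x))) ^ 2 + 2 * norm (- (LINT y|M. f y)) ^ 2"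
      unfolding deviation_def diff_conv_add_uminus by (rule norm_add_squared_le)
    also have "\<dots> \<le> 2 * (1 / N * (\<Sum>n=1..N. norm (f (T n x)) ^ 2)) + 2 * norm (LINT y|M. f y) ^ 2"
      using norm_average_squared_le[of N "\<lambda>n. f (T n x)"] by simp
    finally show "norm (deviation f N x) ^ 2 \<le> 2 * (1 / N * (\<Sum>n=1..N. norm (f (T n x)) ^ 2)) + 2 * norm (LINT y|M. f y) ^ 2" .
  qed
  also have "\<dots> = 2 * (1 / N * (LINT x|M. (\<Sum>n=1..N. norm (f (T n x)) ^ 2))) + 2 * norm (LINT y|M. f y) ^ 2"
  proof -
    have "(LINT x|M. 2 * (a * h x) + b) = 2 * (a * (LINT x|M. h x)) + b" if "integrable M h" for h and a b :: real
      using that by (simp add: prob_space)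
    moreover have "integrable M (\<lambda>x. \<Sum>n=1..N. norm (f (T n x)) ^ 2)"
      using i by (intro Bochner_Integration.integrable_sum) auto
    ultimately show ?thesis by blast
  qed
  also have "(LINT x|M. (\<Sum>n=1..N. norm (f (T n x)) ^ 2)) = (\<Sum>n=1..N. LINT x|M. norm (f (T n x)) ^ 2)"
    using i by (intro Bochner_Integration.integral_sum) auto
  also have "\<dots> = (\<Sum>n=1..N. ?I)"
    using fi by (intro sum.cong refl integral_T) auto
  also have "2 * (1 / N * (\<Sum>n=1..N. ?I)) + 2 * norm (LINT y|M. f y) ^ 2 \<le> 2 * ?I + 2 * ?I"
    using N c by simp
  finally show ?thesis by simp
qed

lemma deviation_add:
  assumes "integrable M f" "integrable M h"
  shows "deviation (\<lambda>x. f x + h x) N x = deviation f N x + deviation h N x"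
  unfolding deviation_def using assms by (simp add: sum.distrib add_divide_distrib)

lemma integral_deviation_add_le:
  assumes f: "square_integrable M f" and h: "square_integrable M h"
  shows "(LINT x|M. norm (deviation (\<lambda>x. f x + h x) N x) ^ 2) \<le>
    2 * (LINT x|M. norm (deviation f N x) ^ 2) + 2 * (LINT x|M. norm (deviation h N x) ^ 2)"
proof -
  have i: "integrable M (\<lambda>x. norm (deviation k N x) ^ 2)" if "square_integrable M k" for k
    using square_integrable_deviation[OF that] by (simp add: square_integrable_def)
  have "(LINT x|M. norm (deviation (\<lambda>x. f x + h x) N x) ^ 2) \<le>
      (LINT x|M. 2 * norm (deviation f N x) ^ 2 + 2 * norm (deviation h N x) ^ 2)"
  proof (rule integral_mono)
    show "integrable M (\<lambda>x. norm (deviation (\<lambda>x. f x + h x) N x) ^ 2)"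
      by (intro i square_integrable_add f h)
    show "integrable M (\<lambda>x. 2 * norm (deviation f N x) ^ 2 + 2 * norm (deviation h N x) ^ 2)"
      using i[OF f] i[OF h] by simp
  qed (simp add: deviation_add square_integrable_integrable f h norm_add_squared_le)
  also have "\<dots> = 2 * (LINT x|M. norm (deviation f N x) ^ 2) + 2 * (LINT x|M. norm (deviation h N x) ^ 2)"
    using i[OF f] i[OF h] by simp
  finally show ?thesis .
qed

lemma mean_converges_add:
  assumes "mean_converges f" "mean_converges h"
  shows "mean_converges (\<lambda>x. f x + h x)"
  unfolding mean_converges_def
proof
  show "square_integrable M (\<lambda>x. f x + h x)"
    using assms by (auto simp: mean_converges_def intro: square_integrable_add)
  show "(\<lambda>N. LINT x|M. norm (deviation (\<lambda>x. f x + h x) N x) ^ 2) \<longlonglongrightarrow> 0"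
  proof (rule tendsto_sandwich[OF _ _ tendsto_const])
    show "(\<lambda>N. 2 * (LINT x|M. norm (deviation f N x) ^ 2) + 2 * (LINT x|M. norm (deviation h N x) ^ 2)) \<longlonglongrightarrow> 0"
      using assms by (auto simp: mean_converges_def intro!: tendsto_eq_intros)
  qed (use assms in \<open>auto simp: mean_converges_def intro!: always_eventually integral_deviation_add_le\<close>)
qed

lemma mean_converges_mult:
  assumes "mean_converges f"
  shows "mean_converges (\<lambda>x. c * f x)"
proof -
  have "deviation (\<lambda>x. c * f x) N x = c * deviation f N x" for N x
    unfolding deviation_def by (simp add: sum_distrib_left[symmetric] right_diff_distrib)
  then have "(\<lambda>N. LINT x|M. norm (deviation (\<lambda>x. c * f x) N x) ^ 2) =
      (\<lambda>N. norm c ^ 2 * (LINT x|M. norm (deviation f N x) ^ 2))"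
    by (simp add: norm_mult power_mult_distrib)
  then show ?thesis using assms
    by (auto simp: mean_converges_def square_integrable_mult intro!: tendsto_eq_intros)
qed

lemma mean_converges_cnj:
  assumes "mean_converges f"
  shows "mean_converges (\<lambda>x. cnj (f x))"
proof -
  have "deviation (\<lambda>x. cnj (f x)) N x = cnj (deviation f N x)" for N x
    unfolding deviation_def by simp
  then have "(\<lambda>N. LINT x|M. norm (deviation (\<lambda>x. cnj (f x)) N x) ^ 2) =
      (\<lambda>N. LINT x|M. norm (deviation f N x) ^ 2)"
    by simp
  then show ?thesis using assms by (auto simp: mean_converges_def square_integrable_def intro: borel_measurable_cnj)
qed

lemma mean_converges_const: "mean_converges (\<lambda>x. c)"
proof -
  have "deviation (\<lambda>x. c) N x = 0" if "N \<ge> 1" for N x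
    using that by (simp add: deviation_def prob_space)
  then have "\<forall>\<^sub>F N in sequentially. (LINT x|M. norm (deviation (\<lambda>x. c) N x) ^ 2) = 0"
    unfolding eventually_sequentially by (intro exI[of _ 1]) simp
  then show ?thesis
    by (simp add: mean_converges_def square_integrable_const tendsto_eventually)
qed

lemma mean_converges_sum:
  "finite A \<Longrightarrow> (\<And>i. i \<in> A \<Longrightarrow> mean_converges (f i)) \<Longrightarrow> mean_converges (\<lambda>x. \<Sum>i\<in>A. f i x)"
  by (induction A rule: finite_induct) (auto intro: mean_converges_add mean_converges_const)

text \<open>Stability under L2 limits, phrased through pointwise dominated convergence because all
  approximations to come are of that kind.\<close>

lemma mean_converges_dominated:
  assumes h: "\<And>i. mean_converges (h i)" and f: "f \<in> borel_measurable M"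
    and lim: "AE x in M. (\<lambda>i. h i x) \<longlonglongrightarrow> f x"
    and w: "integrable M (\<lambda>x. w x ^ 2)" and bound: "\<And>i. AE x in M. norm (h i x) \<le> w x"
  shows "mean_converges f"
proof -
  have hm [measurable]: "h i \<in> borel_measurable M" for i
    using h by (auto simp: mean_converges_def square_integrable_def)
  have hs: "square_integrable M (h i)" for i using h by (simp add: mean_converges_def)
  have "AE x in M. \<forall>i. norm (h i x) \<le> w x" using bound by (simp add: AE_all_countable)
  with lim have fw: "AE x in M. norm (f x) \<le> w x"
    by eventually_elim (auto intro: LIMSEQ_le_const2[OF tendsto_norm])
  have fs: "square_integrable M f"
    unfolding square_integrable_def
  proof
    show "integrable M (\<lambda>x. norm (f x) ^ 2)"
    proof (rule Bochner_Integration.integrable_bound[OF w])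
      show "AE x in M. norm (norm (f x) ^ 2) \<le> norm (w x ^ 2)"
        using fw by eventually_elim (simp add: power_mono)
    qed (use f in measurable)
  qed fact
  have conv: "(\<lambda>i. LINT x|M. norm (f x - h i x) ^ 2) \<longlonglongrightarrow> (LINT x|M. 0)"
  proof (rule integral_dominated_convergence[where w="\<lambda>x. 4 * w x ^ 2"])
    show "AE x in M. (\<lambda>i. norm (f x - h i x) ^ 2) \<longlonglongrightarrow> 0"
      using lim by eventually_elim (auto intro!: tendsto_eq_intros)
    show "AE x in M. norm (norm (f x - h i x) ^ 2) \<le> 4 * w x ^ 2" for i
      using fw bound[of i]
    proof eventually_elim
      case (elim x)
      then have "norm (f x) ^ 2 \<le> w x ^ 2" "norm (h i x) ^ 2 \<le> w x ^ 2" by (auto intro: power_mono)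
      then show ?case using norm_add_squared_le[of "f x" "- h i x"] by simp
    qed
  qed (use f w in auto)
  show ?thesis unfolding mean_converges_def
  proof (intro conjI fs tendstoI)
    fix e :: real assume e: "e > 0"
    \<comment> \<open>The budget is 2 (e / 4) for \<open>h i\<close> and 2 * 4 (e / 16) for the
      remainder, where 4 is the constant of \<open>integral_deviation_le\<close>.\<close>
    from conv have "\<forall>\<^sub>F i in sequentially. (LINT x|M. norm (f x - h i x) ^ 2) < e / 16"
      using order_tendstoD(2)[OF conv, of "e / 16"] e by simp
    then obtain i where i: "(LINT x|M. norm (f x - h i x) ^ 2) < e / 16"
      by (auto simp: eventually_sequentially)
    have "(\<lambda>N. LINT x|M. norm (deviation (h i) N x) ^ 2) \<longlonglongrightarrow> 0" using h by (simp add: mean_converges_def)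
    then have "\<forall>\<^sub>F N in sequentially. (LINT x|M. norm (deviation (h i) N x) ^ 2) < e / 4"
      using order_tendstoD(2)[of _ 0 sequentially "e / 4"] e by simp
    moreover have "\<forall>\<^sub>F N in sequentially. N \<ge> 1" by (rule eventually_ge_at_top)
    ultimately show "\<forall>\<^sub>F N in sequentially. dist (LINT x|M. norm (deviation f N x) ^ 2) 0 < e"
    proof eventually_elim
      case (elim N)
      have "(LINT x|M. norm (deviation f N x) ^ 2) = (LINT x|M. norm (deviation (\<lambda>x. h i x + (f x - h i x)) N x) ^ 2)"
        by simp
      also have "\<dots> \<le> 2 * (LINT x|M. norm (deviation (h i) N x) ^ 2) + 2 * (LINT x|M. norm (deviation (\<lambda>x. f x - h i x) N x) ^ 2)"
        by (intro integral_deviation_add_le square_integrable_diff hs fs)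
      also have "(LINT x|M. norm (deviation (\<lambda>x. f x - h i x) N x) ^ 2) \<le> 4 * (LINT x|M. norm (f x - h i x) ^ 2)"
        by (intro integral_deviation_le square_integrable_diff hs fs elim)
      finally have "(LINT x|M. norm (deviation f N x) ^ 2) < e" using elim i by simp
      then show ?case by simp
    qed
  qed
qed

text \<open>The constant sequence in \<open>mean_converges_dominated\<close>.\<close>

lemma mean_converges_AE_cong:
  assumes "mean_converges h" "f \<in> borel_measurable M" "AE x in M. h x = f x"
  shows "mean_converges f"
proof (rule mean_converges_dominated[where h="\<lambda>_. h" and w="\<lambda>x. norm (h x)"])
  show "AE x in M. (\<lambda>i::nat. h x) \<longlonglongrightarrow> f x" using assms(3) by eventually_elim simp
qed (use assms in \<open>auto simp: mean_converges_def square_integrable_def\<close>)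

text \<open>Simple functions are combinations of indicators, and the approximating ones stay below
  \<open>2 * norm (f x)\<close>, which serves as the majorant.\<close>

lemma mean_converges_square_integrable:
  assumes ind: "\<And>A. A \<in> sets M \<Longrightarrow> mean_converges (\<lambda>x. of_real (indicator A x))"
    and f: "square_integrable M f"
  shows "mean_converges f"
proof -
  have fm: "f \<in> borel_measurable M" using f by (simp add: square_integrable_def)
  obtain s where s: "\<And>i. simple_function M (s i)" "\<And>x. x \<in> space M \<Longrightarrow> (\<lambda>i. s i x) \<longlonglongrightarrow> f x"
    "\<And>i x. x \<in> space M \<Longrightarrow> norm (s i x) \<le> 2 * norm (f x)"
    using borel_measurable_implies_sequence_metric[OF fm, of 0] unfolding norm_conv_dist by metis
  have "mean_converges (s i)" for i
  proof (rule mean_converges_AE_cong)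
    show "mean_converges (\<lambda>x. \<Sum>y\<in>s i ` space M. y * of_real (indicator (s i -` {y} \<inter> space M) x))"
    proof (rule mean_converges_sum)
      show "finite (s i ` space M)" using s(1) by (rule simple_functionD)
      show "mean_converges (\<lambda>x. y * of_real (indicator (s i -` {y} \<inter> space M) x))" for y
        by (intro mean_converges_mult ind simple_functionD(2) s)
    qed
    show "s i \<in> borel_measurable M" using s(1) by (rule borel_measurable_simple_function)
    show "AE x in M. (\<Sum>y\<in>s i ` space M. y * of_real (indicator (s i -` {y} \<inter> space M) x)) = s i x"
    proof (rule AE_I2)
      fix x assume x: "x \<in> space M"
      have "(\<Sum>y\<in>s i ` space M. y * of_real (indicator (s i -` {y} \<inter> space M) x)) =
          (\<Sum>y\<in>s i ` space M. if s i x = y then y else 0)"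
        using x by (intro sum.cong) (auto simp: indicator_def)
      also have "\<dots> = s i x"
        using x simple_functionD(1)[OF s(1)] by (simp add: sum.delta')
      finally show "(\<Sum>y\<in>s i ` space M. y * of_real (indicator (s i -` {y} \<inter> space M) x)) = s i x" .
    qed
  qed
  then show ?thesis
  proof (rule mean_converges_dominated[OF _ fm])
    show "AE x in M. (\<lambda>i. s i x) \<longlonglongrightarrow> f x" using s(2) by (rule AE_I2)
    show "AE x in M. norm (s i x) \<le> 2 * norm (f x)" for i using s(3) by (rule AE_I2)
    show "integrable M (\<lambda>x. (2 * norm (f x)) ^ 2)"
      using f by (simp add: square_integrable_def power_mult_distrib)
  qed
qed

text \<open>A Dynkin system argument: complements are handled by linearity, disjoint unions by
  dominated limits of partial sums.\<close>

lemma mean_converges_indicator_induct: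
  assumes G: "Int_stable G" "G \<subseteq> Pow (space M)" and A: "A \<in> sigma_sets (space M) G"
    and sub: "sigma_sets (space M) G \<subseteq> sets M"
    and basic: "\<And>A. A \<in> G \<Longrightarrow> mean_converges (\<lambda>x. of_real (indicator A x))"
  shows "mean_converges (\<lambda>x. of_real (indicator A x))"
  using G A
proof (induction rule: sigma_sets_induct_disjoint)
  case (basic A)
  then show ?case by (rule assms(5))
next
  case empty
  then show ?case using mean_converges_const[of 0] by simp
next
  case (compl A)
  then have As: "A \<in> sets M" using sub by auto
  have "mean_converges (\<lambda>x. 1 + (-1) * of_real (indicator A x))"
    by (intro mean_converges_add mean_converges_const mean_converges_mult compl)
  then show ?case
    by (rule mean_converges_AE_cong) (use As in \<open>auto intro!: AE_I2 simp: indicator_def\<close>)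
next
  case (union A)
  have As: "A i \<in> sets M" for i using union(2) sub by auto
  have "mean_converges (\<lambda>x. \<Sum>i<n. of_real (indicator (A i) x))" for n
    by (intro mean_converges_sum union) auto
  then show ?case
  proof (rule mean_converges_dominated[where w="\<lambda>_. 1"])
    have "(\<lambda>n. \<Sum>i<n. indicator (A i) x) \<longlonglongrightarrow> (indicator (\<Union>i. A i) x :: real)" for x
      using indicator_sums[of A x] union(1) by (simp add: sums_def disjoint_family_on_def)
    then show "AE x in M. (\<lambda>n. \<Sum>i<n. complex_of_real (indicator (A i) x)) \<longlonglongrightarrow> of_real (indicator (\<Union>i. A i) x)"
      by (simp only: of_real_sum[symmetric]) (intro AE_I2 tendsto_of_real)
    have "(\<Sum>i<n. indicator (A i) x :: real) = indicator (\<Union>i<n. A i) x" for n x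
      using union(1) by (intro indicator_UN_disjoint[symmetric]) (auto simp: disjoint_family_on_def)
    then show "AE x in M. norm (\<Sum>i<n. complex_of_real (indicator (A i) x)) \<le> 1" for n
      by (simp only: of_real_sum[symmetric] norm_of_real) (simp add: indicator_def)
  qed (use As in auto)
qed

end

text \<open>The density argument in concrete form. Powers generate trigonometric polynomials, these
  approximate continuous functions, which in turn approximate indicators of relatively open sets;
  Borel sets, completed sets and square-integrable functions follow by the closure
  properties.\<close>

lemma mean_converges_circle:
  assumes T: "measure_preserving_sequence circle_measure T"
    and powers: "\<And>l. l \<ge> 1 \<Longrightarrow> measure_preserving_sequence.mean_converges circle_measure T (\<lambda>z. z ^ l)"
    and f: "square_integrable circle_measure f"
  shows "measure_preserving_sequence.mean_converges circle_measure T f"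
proof -
  interpret measure_preserving_sequence circle_measure T by fact
  have poly: "mean_converges p" if "circle_poly p" for p
    using that
  proof induction
    case (monomial c i j)
    have "mean_converges (\<lambda>z. z ^ i * cnj z ^ j)"
    proof -
      have u: "z ^ k * cnj z ^ k = 1" if "norm z = 1" for z k
        using cnj_cancel_unit[OF that] by (simp add: power_mult_distrib[symmetric])
      have m: "(\<lambda>z. z ^ i * cnj z ^ j) \<in> borel_measurable circle_measure"
        by (intro continuous_on_circle_measurable continuous_intros)
      \<comment> \<open>Exponent 0 is a constant and negative exponents are conjugates of positive
        ones, under which mean convergence is invariant. This is why testing l \<ge> 1
        suffices.\<close>
      consider "i = j" | k where "k \<ge> 1" "i = j + k" | k where "k \<ge> 1" "j = i + k"
        using less_imp_add_positive[of i j] less_imp_add_positive[of j i]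
        by (cases i j rule: linorder_cases) auto
      then show ?thesis
      proof cases
        case 1
        have "AE z in circle_measure. 1 = z ^ i * cnj z ^ j"
          using AE_norm_one by eventually_elim (simp add: 1 u)
        then show ?thesis by (rule mean_converges_AE_cong[OF mean_converges_const m])
      next
        case 2
        have "AE z in circle_measure. z ^ k = z ^ i * cnj z ^ j"
          using AE_norm_one
        proof eventually_elim
          case (elim z)
          then show ?case using u[OF elim, of j] by (simp add: 2 power_add mult_ac)
        qed
        then show ?thesis by (rule mean_converges_AE_cong[OF powers[OF 2(1)] m])
      next
        case 3
        have "AE z in circle_measure. cnj (z ^ k) = z ^ i * cnj z ^ j"
          using AE_norm_one
        proof eventually_elim
          case (elim z)
          then show ?case using u[OF elim, of i] by (simp add: 3 power_add mult_ac)
        qed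
        then show ?thesis by (rule mean_converges_AE_cong[OF mean_converges_cnj[OF powers[OF 3(1)]] m])
      qed
    qed
    then show ?case by (rule mean_converges_mult)
  next
    case (add p q)
    then show ?case by (intro mean_converges_add)
  qed
  have cont: "mean_converges (\<lambda>z. of_real (h z))" if h: "continuous_on UNIV h" for h :: "complex \<Rightarrow> real"
  proof -
    have hc: "continuous_on (sphere 0 1) h" using h continuous_on_subset by blast
    have "\<exists>p :: complex \<Rightarrow> real. circle_poly (\<lambda>z. of_real (p z)) \<and> (\<forall>z. norm z = 1 \<longrightarrow> \<bar>h z - p z\<bar> < 1 / Suc i)" for i
      using circle_poly_approx[OF hc, of "1 / Suc i"] by auto
    then obtain p :: "nat \<Rightarrow> complex \<Rightarrow> real" where p: "\<And>i. circle_poly (\<lambda>z. of_real (p i z))"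
      "\<And>i z. norm z = 1 \<Longrightarrow> \<bar>h z - p i z\<bar> < 1 / Suc i"
      by metis
    have "bounded (h ` sphere 0 1)"
      by (intro compact_imp_bounded compact_continuous_image hc) auto
    then obtain C where C: "\<forall>z\<in>sphere 0 1. norm (h z) \<le> C" by (auto simp: bounded_iff)
    show ?thesis
    proof (rule mean_converges_dominated[where w="\<lambda>_. C + 1"])
      show "mean_converges (\<lambda>z. of_real (p i z))" for i by (intro poly p)
      show "(\<lambda>z. complex_of_real (h z)) \<in> borel_measurable circle_measure"
        by (intro continuous_on_circle_measurable continuous_intros hc)
      show "AE z in circle_measure. (\<lambda>i. complex_of_real (p i z)) \<longlonglongrightarrow> of_real (h z)"
        using AE_norm_one
      proof eventually_elim
        case (elim z)
        have "(\<lambda>i. h z - p i z) \<longlonglongrightarrow> 0"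
        proof (rule Lim_null_comparison)
          show "(\<lambda>i. 1 / real (Suc i)) \<longlonglongrightarrow> 0" by real_asymp
          show "\<forall>\<^sub>F i in sequentially. norm (h z - p i z) \<le> 1 / real (Suc i)"
            using p(2)[OF elim] by (intro always_eventually allI) (simp add: less_imp_le)
        qed
        from tendsto_diff[OF tendsto_const[of "h z"] this] have "(\<lambda>i. p i z) \<longlonglongrightarrow> h z" by simp
        then show ?case by (rule tendsto_of_real)
      qed
      show "AE z in circle_measure. norm (complex_of_real (p i z)) \<le> C + 1" for i
        using AE_norm_one
      proof eventually_elim
        case (elim z)
        have "\<bar>h z - p i z\<bar> < 1" using p(2)[OF elim, of i] by (rule less_le_trans) simp
        moreover have "\<bar>h z\<bar> \<le> C" using C elim by simp
        ultimately show ?case by simp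
      qed
    qed simp
  qed
  have borel: "mean_converges (\<lambda>z. of_real (indicator A z))" if "A \<in> sets borel_circle" for A
  proof (rule mean_converges_indicator_induct)
    let ?G = "{U \<inter> sphere 0 1 |U :: complex set. open U}"
    show "Int_stable ?G"
    proof (rule Int_stableI, safe)
      fix U V :: "complex set" assume "open U" "open V"
      then show "\<exists>W. U \<inter> sphere 0 1 \<inter> (V \<inter> sphere 0 1) = W \<inter> sphere 0 1 \<and> open W"
        by (intro exI[of _ "U \<inter> V"]) auto
    qed
    show "?G \<subseteq> Pow (space circle_measure)" by (auto simp: space_circle_measure)
    show "A \<in> sigma_sets (space circle_measure) ?G"
      using that by (simp add: space_circle_measure open_sets_generate_circle)
    show sub: "sigma_sets (space circle_measure) ?G \<subseteq> sets circle_measure"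
      unfolding space_circle_measure open_sets_generate_circle[symmetric]
      unfolding circle_measure_def by auto
    fix X assume "X \<in> ?G"
    then obtain U where U: "open U" "X = U \<inter> sphere 0 1" by auto
    have X: "X \<in> sets circle_measure" using \<open>X \<in> ?G\<close> sub by blast
    obtain h :: "nat \<Rightarrow> complex \<Rightarrow> real" where h: "\<And>n. continuous_on UNIV (h n)" "\<And>n z. 0 \<le> h n z" "\<And>n z. h n z \<le> 1"
      "\<And>z. (\<lambda>n. h n z) \<longlonglongrightarrow> indicator U z"
      using indicator_open_approx[OF U(1)] by metis
    show "mean_converges (\<lambda>z. of_real (indicator X z))"
    proof (rule mean_converges_dominated[where w="\<lambda>_. 1"])
      show "mean_converges (\<lambda>z. of_real (h n z))" for n by (intro cont h)
      show "(\<lambda>z. complex_of_real (indicator X z)) \<in> borel_measurable circle_measure"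
        using X by measurable
      show "AE z in circle_measure. (\<lambda>n. complex_of_real (h n z)) \<longlonglongrightarrow> of_real (indicator X z)"
        using AE_norm_one
      proof eventually_elim
        case (elim z)
        then have "indicator X z = (indicator U z :: real)" by (auto simp: U indicator_def)
        then show ?case using tendsto_of_real[OF h(4)] by metis
      qed
      show "AE z in circle_measure. norm (complex_of_real (h n z)) \<le> 1" for n
        using h by (intro AE_I2) simp
    qed simp
  qed
  show ?thesis
  proof (rule mean_converges_square_integrable[OF _ f])
    fix A assume A: "A \<in> sets circle_measure"
    then have A': "A \<in> completion borel_circle" by (simp add: circle_measure_def)
    \<comment> \<open>A set of the completed algebra differs from its Borel main part by a null set
      only.\<close>
    have "AE z in circle_measure. z \<in> main_part borel_circle A \<longleftrightarrow> z \<in> A"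
      unfolding circle_measure_def by (rule AE_completion[OF AE_in_main_part[OF A']])
    then have eq: "AE z in circle_measure. complex_of_real (indicator (main_part borel_circle A) z) = of_real (indicator A z)"
      by eventually_elim (auto simp: indicator_def)
    show "mean_converges (\<lambda>z. of_real (indicator A z))"
      by (rule mean_converges_AE_cong[OF borel[OF main_part_sets[OF A']] _ eq]) (use A in measurable)
  qed
qed

section \<open>Expansion into correlations and the ergodicity criterion\<close>

lemma norm_sum_squared_expand:
  fixes x :: "nat \<Rightarrow> complex"
  shows "norm (\<Sum>n=1..N. x n) ^ 2 =
    (\<Sum>n=1..N. norm (x n) ^ 2) + 2 * Re (\<Sum>m=1..N-1. \<Sum>n=m+1..N. x n * cnj (x m))"
proof (induction N)
  case (Suc N)
  have "(\<Sum>m=1..N. \<Sum>n=m+1..Suc N. x n * cnj (x m)) =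
      (\<Sum>m=1..N. (\<Sum>n=m+1..N. x n * cnj (x m)) + x (Suc N) * cnj (x m))"
    by (intro sum.cong) auto
  also have "\<dots> = (\<Sum>m=1..N. \<Sum>n=m+1..N. x n * cnj (x m)) + x (Suc N) * cnj (\<Sum>m=1..N. x m)"
    by (simp add: sum.distrib sum_distrib_left)
  \<comment> \<open>The row m = N is an empty sum, which matches the upper limit N - 1.\<close>
  also have "(\<Sum>m=1..N. \<Sum>n=m+1..N. x n * cnj (x m)) = (\<Sum>m=1..N-1. \<Sum>n=m+1..N. x n * cnj (x m))"
    by (rule sum.mono_neutral_right) auto
  finally have "Re (\<Sum>m=1..N. \<Sum>n=m+1..Suc N. x n * cnj (x m)) =
      Re (\<Sum>m=1..N-1. \<Sum>n=m+1..N. x n * cnj (x m)) + Re (x (Suc N) * cnj (\<Sum>m=1..N. x m))"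
    by (simp only: plus_complex.sel)
  moreover have "norm (\<Sum>n=1..Suc N. x n) ^ 2 = norm (x (Suc N) - (- (\<Sum>n=1..N. x n))) ^ 2"
    by (simp add: add.commute)
  moreover have "\<dots> = norm (x (Suc N)) ^ 2 + norm (\<Sum>n=1..N. x n) ^ 2 + 2 * Re (x (Suc N) * cnj (\<Sum>m=1..N. x m))"
    unfolding cmod_diff_squared complex_cnj_minus norm_minus_cancel by simp
  ultimately show ?case using Suc by simp
qed simp

theorem theorem1p2:
  fixes g :: "nat \<Rightarrow> complex \<Rightarrow> complex"
  assumes "\<And>n. n \<ge> 1 \<Longrightarrow> inner_function (g n)"
    and "\<And>n. n \<ge> 1 \<Longrightarrow> g n 0 = 0"
  shows "ergodic_sequence circle_measure (\<lambda>n. boundary_map (comp_seq g 0 n)) \<longleftrightarrow>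
    (\<forall>l\<ge>1. (\<lambda>N. Re (1 / of_nat N ^ 2 *
        (\<Sum>m=1..N-1. \<Sum>n=m+1..N. (deriv (comp_seq g m n) 0) ^ l))) \<longlonglongrightarrow> 0)"
proof -
  define T where "T n = boundary_map (comp_seq g 0 n)" for n
  have inner: "inner_function (comp_seq g m n)" "comp_seq g m n 0 = 0" if "m \<le> n" for m n
    using comp_seq_inner[of g, OF assms that] by auto
  have T: "measure_preserving_sequence circle_measure T"
    unfolding T_def by unfold_locales (intro measure_preserving_boundary_map inner le0)
  interpret measure_preserving_sequence circle_measure T by (rule T)
  have sq_power: "square_integrable circle_measure (\<lambda>z. z ^ l)" for l
    unfolding square_integrable_def
    by (intro conjI continuous_on_circle_measurable integrable_circle_continuous continuous_intros)
  have Tm: "T n \<in> borel_measurable circle_measure" for n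
    unfolding T_def by (intro boundary_map_borel_measurable inner le0)
  have Tn: "norm (T n z) = 1" for n z by (simp add: T_def)
  have corr: "(LINT z|circle_measure. T n z ^ l * cnj (T m z ^ l)) = deriv (comp_seq g m n) 0 ^ l"
    if "m \<le> n" for m n l
    unfolding T_def comp_seq_compose[OF le0 that]
    by (rule integral_boundary_map_correlation) (use inner that in auto)
  \<comment> \<open>The summand 1 / N is the diagonal, N unimodular terms divided by N^2. At N = 0
    both sides are 0 because division by 0 gives 0.\<close>
  have dev: "(LINT z|circle_measure. norm (deviation (\<lambda>z. z ^ l) N z) ^ 2) =
      1 / N + 2 * Re (1 / of_nat N ^ 2 * (\<Sum>m=1..N-1. \<Sum>n=m+1..N. deriv (comp_seq g m n) 0 ^ l))"
    if l: "l \<ge> 1" for l N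
  proof -
    \<comment> \<open>Here l \<ge> 1 enters: the mean vanishes, so the deviation is the plain
      average of the \<open>T n z ^ l\<close>.\<close>
    have int0: "(LINT z|circle_measure. z ^ l) = 0"
    proof -
      have "(LINT z|circle_measure. z ^ l) = 0 ^ l"
        by (rule circle_mean_value) (auto intro!: continuous_intros holomorphic_intros)
      then show ?thesis using l by simp
    qed
    let ?c = "\<lambda>m n z. T n z ^ l * cnj (T m z ^ l)"
    have ci: "integrable circle_measure (?c m n)" for m n
      by (rule integrable_circle[where B=1]) (use Tm in \<open>auto simp: norm_mult norm_power Tn intro: borel_measurable_cnj\<close>)
    have "norm (deviation (\<lambda>z. z ^ l) N z) ^ 2 =
        1 / N ^ 2 * (N + 2 * Re (\<Sum>m=1..N-1. \<Sum>n=m+1..N. ?c m n z))" for z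
    proof -
      have "norm (deviation (\<lambda>z. z ^ l) N z) ^ 2 = 1 / N ^ 2 * norm (\<Sum>n=1..N. T n z ^ l) ^ 2"
        unfolding deviation_def int0 by (simp add: norm_divide power_divide)
      also have "norm (\<Sum>n=1..N. T n z ^ l) ^ 2 = N + 2 * Re (\<Sum>m=1..N-1. \<Sum>n=m+1..N. ?c m n z)"
        unfolding norm_sum_squared_expand by (simp add: norm_power Tn)
      finally show ?thesis .
    qed
    then have "(LINT z|circle_measure. norm (deviation (\<lambda>z. z ^ l) N z) ^ 2) =
        (LINT z|circle_measure. 1 / N ^ 2 * (N + 2 * Re (\<Sum>m=1..N-1. \<Sum>n=m+1..N. ?c m n z)))"
      by (simp only:)
    also have "\<dots> = 1 / N ^ 2 * (N + 2 * Re (LINT z|circle_measure. (\<Sum>m=1..N-1. \<Sum>n=m+1..N. ?c m n z)))"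
    proof -
      have "(LINT z|circle_measure. a * (b + 2 * Re (h z))) = a * (b + 2 * Re (LINT z|circle_measure. h z))"
        if "integrable circle_measure h" for h and a b :: real
        using that by (simp add: circ.prob_space)
      moreover have "integrable circle_measure (\<lambda>z. \<Sum>m=1..N-1. \<Sum>n=m+1..N. ?c m n z)"
        by (intro Bochner_Integration.integrable_sum ci)
      ultimately show ?thesis by blast
    qed
    also have "(LINT z|circle_measure. (\<Sum>m=1..N-1. \<Sum>n=m+1..N. ?c m n z)) =
        (\<Sum>m=1..N-1. \<Sum>n=m+1..N. LINT z|circle_measure. ?c m n z)"
      using ci by (subst Bochner_Integration.integral_sum | simp)+
    also have "\<dots> = (\<Sum>m=1..N-1. \<Sum>n=m+1..N. deriv (comp_seq g m n) 0 ^ l)"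
      by (intro sum.cong refl corr) auto
    also have "1 / N ^ 2 * (N + 2 * Re S) = 1 / N + 2 * Re (1 / of_nat N ^ 2 * S)" for S
    proof -
      have "1 / of_nat N ^ 2 * S = of_real (1 / N ^ 2) * S" by simp
      then have "Re (1 / of_nat N ^ 2 * S) = 1 / N ^ 2 * Re S" by (simp only: Re_complex_of_real times_complex.sel Im_complex_of_real
          mult_zero_left diff_zero)
      then show ?thesis by (cases "N = 0") (simp_all add: distrib_left power2_eq_square)
    qed
    finally show ?thesis .
  qed
  have power_iff: "mean_converges (\<lambda>z. z ^ l) \<longleftrightarrow>
      (\<lambda>N. Re (1 / of_nat N ^ 2 * (\<Sum>m=1..N-1. \<Sum>n=m+1..N. deriv (comp_seq g m n) 0 ^ l))) \<longlonglongrightarrow> 0"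
    (is "_ \<longleftrightarrow> ?R \<longlonglongrightarrow> 0") if l: "l \<ge> 1" for l
  proof -
    have inv: "(\<lambda>N. 1 / real N) \<longlonglongrightarrow> 0" by real_asymp
    have "mean_converges (\<lambda>z. z ^ l) \<longleftrightarrow> (\<lambda>N. 1 / real N + 2 * ?R N) \<longlonglongrightarrow> 0"
      by (simp only: mean_converges_def sq_power dev[OF l] simp_thms)
    also have "\<dots> \<longleftrightarrow> ?R \<longlonglongrightarrow> 0"
    proof
      assume "(\<lambda>N. 1 / real N + 2 * ?R N) \<longlonglongrightarrow> 0"
      from tendsto_mult[OF tendsto_const[of "1/2 :: real"] tendsto_diff[OF this inv]] show "?R \<longlonglongrightarrow> 0" by simp
    next
      assume "?R \<longlonglongrightarrow> 0"
      from tendsto_add[OF inv tendsto_mult[OF tendsto_const[of "2 :: real"] this]]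
      show "(\<lambda>N. 1 / real N + 2 * ?R N) \<longlonglongrightarrow> 0" by simp
    qed
    finally show ?thesis .
  qed
  have "ergodic_sequence circle_measure T \<longleftrightarrow> (\<forall>\<phi>. square_integrable circle_measure \<phi> \<longrightarrow> mean_converges \<phi>)"
    unfolding ergodic_sequence_def mean_converges_iff_L2_norm
    using preserving prob_space_circle_measure by blast
  also have "\<dots> \<longleftrightarrow> (\<forall>l\<ge>1. mean_converges (\<lambda>z. z ^ l))"
    using sq_power mean_converges_circle[OF T] by blast
  finally show ?thesis unfolding T_def[abs_def, symmetric] using power_iff by blast
qed

end
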